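(* Let $J$ be a one-sided Jacobi matrix with parameters $a_n>0$, $b_n\in\mathbb{R}$ ($n=1,2,\dots$) such that for some $K\in(0,\infty)$, $$\sup_n|b_n|+\sup_n|a_n|+\sup_n|a_n|^{-1}\le K .$$ Let $\mathcal{R}$ be the set of right limit points of $J$, and for $r\in\mathcal R$ let $J^{(r)}$ be the corresponding two-sided Jacobi matrix. Then $$\overline{\bigcup_{r\in\mathcal{R}}\sigma(J^{(r)})}=\sigma_{\mathrm{ess}}(J).$$
   Context: The Jacobi matrix $J$ is the selfadjoint tridiagonal operator on $\ell^2(\{1,2,\dots\})$ with diagonal entries $b_1,b_2,\dots$ and off-diagonal entries $a_1,a_2,\dots$ (i.e. $J_{n,n}=b_n$, $J_{n,n+1}=J_{n+1,n}=a_n$). A right limit point of $J$ is a two-sided Jacobi matrix $J^{(r)}$ on $\ell^2(\mathbb{Z})$ with parameters $\{a_n^{(r)},b_n^{(r)}\}_{n=-\infty}^\infty$ for which there is a subsequence $n_j\to\infty$ such that, for each fixed $\ell=0,\pm1,\pm2,\dots$, $a_{n_j+\ell}\to a_\ell^{(r)}$ and $b_{n_j+\ell}\to b_\ell^{(r)}$ as $j\to\infty$. $\sigma,\sigma_{\mathrm{ess}}$ denote spectrum and essential spectrum. *)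

theory Defs
  imports "HOL-Analysis.Analysis"
begin

text \<open>The complex Hilbert space of square-summable families indexed by \<open>I\<close>; a vector is
  represented by its extension by zero to the whole index type.\<close>

definition ell2 :: "'i set \<Rightarrow> ('i \<Rightarrow> complex) set" where
  "ell2 I = {u. (\<forall>i. i \<notin> I \<longrightarrow> u i = 0) \<and> (\<lambda>i. (cmod (u i))\<^sup>2) summable_on I}"

definition ell2_norm :: "'i set \<Rightarrow> ('i \<Rightarrow> complex) \<Rightarrow> real" where
  "ell2_norm I u = sqrt (\<Sum>\<^sub>\<infinity>i\<in>I. (cmod (u i))\<^sup>2)"

text \<open>In the following, \<open>T\<close> is an everywhere defined operator on \<^term>\<open>ell2 I\<close>.\<close>

definition shifted :: "(('i \<Rightarrow> complex) \<Rightarrow> ('i \<Rightarrow> complex)) \<Rightarrow> complex \<Rightarrow>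
    ('i \<Rightarrow> complex) \<Rightarrow> ('i \<Rightarrow> complex)" where
  "shifted T z u = (\<lambda>i. T u i - z * u i)"

text \<open>\<open>T - z\<close> has a bounded two-sided inverse on \<^term>\<open>ell2 I\<close>; the constant \<open>C\<close> bounds the norm of
  the inverse.\<close>

definition resolvent_set :: "'i set \<Rightarrow> (('i \<Rightarrow> complex) \<Rightarrow> ('i \<Rightarrow> complex)) \<Rightarrow> complex set" where
  "resolvent_set I T = {z. bij_betw (shifted T z) (ell2 I) (ell2 I) \<and>
     (\<exists>C. \<forall>u\<in>ell2 I. ell2_norm I u \<le> C * ell2_norm I (shifted T z u))}"

definition spectrum :: "'i set \<Rightarrow> (('i \<Rightarrow> complex) \<Rightarrow> ('i \<Rightarrow> complex)) \<Rightarrow> complex set" where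
  "spectrum I T = - resolvent_set I T"

definition eigenspace :: "'i set \<Rightarrow> (('i \<Rightarrow> complex) \<Rightarrow> ('i \<Rightarrow> complex)) \<Rightarrow> complex \<Rightarrow>
    ('i \<Rightarrow> complex) set" where
  "eigenspace I T z = {u \<in> ell2 I. T u = (\<lambda>i. z * u i)}"

definition finite_dim :: "('i \<Rightarrow> complex) set \<Rightarrow> bool" where
  "finite_dim E \<longleftrightarrow> (\<exists>F. finite F \<and> F \<subseteq> E \<and> (\<forall>u\<in>E. \<exists>c. u = (\<lambda>i. \<Sum>f\<in>F. c f * f i)))"

text \<open>Discrete spectrum of a selfadjoint operator: the isolated points of the spectrum that are
  eigenvalues of finite multiplicity. By selfadjointness the geometric and the algebraic
  multiplicity agree. The essential spectrum is the rest of the spectrum.\<close>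

definition discrete_spectrum :: "'i set \<Rightarrow> (('i \<Rightarrow> complex) \<Rightarrow> ('i \<Rightarrow> complex)) \<Rightarrow> complex set" where
  "discrete_spectrum I T = {z. z isolated_in spectrum I T \<and>
     eigenspace I T z \<noteq> {\<lambda>_. 0} \<and> finite_dim (eigenspace I T z)}"

definition essential_spectrum :: "'i set \<Rightarrow> (('i \<Rightarrow> complex) \<Rightarrow> ('i \<Rightarrow> complex)) \<Rightarrow> complex set" where
  "essential_spectrum I T = spectrum I T - discrete_spectrum I T"

text \<open>The one-sided Jacobi matrix acts on \<^term>\<open>ell2 {1::nat..}\<close>, so that row \<open>1\<close> has no
  subdiagonal entry. The values \<open>a 0\<close> and \<open>b 0\<close> are irrelevant.\<close>

definition jacobi_one_sided :: "(nat \<Rightarrow> real) \<Rightarrow> (nat \<Rightarrow> real) \<Rightarrow>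
    (nat \<Rightarrow> complex) \<Rightarrow> (nat \<Rightarrow> complex)" where
  "jacobi_one_sided a b u = (\<lambda>n.
     if n = 0 then 0
     else if n = 1 then of_real (b 1) * u 1 + of_real (a 1) * u 2
     else of_real (a (n - 1)) * u (n - 1) + of_real (b n) * u n + of_real (a n) * u (n + 1))"

definition jacobi_two_sided :: "(int \<Rightarrow> real) \<Rightarrow> (int \<Rightarrow> real) \<Rightarrow>
    (int \<Rightarrow> complex) \<Rightarrow> (int \<Rightarrow> complex)" where
  "jacobi_two_sided a b u = (\<lambda>n.
     of_real (a (n - 1)) * u (n - 1) + of_real (b n) * u n + of_real (a n) * u (n + 1))"

text \<open>Parameters of the right limit points. For fixed \<open>l\<close> the index \<open>m j + l\<close> is positive for all
  but finitely many \<open>j\<close>, so the truncation by \<^const>\<open>nat\<close> does not affect the limits.\<close>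

definition right_limits :: "(nat \<Rightarrow> real) \<Rightarrow> (nat \<Rightarrow> real) \<Rightarrow>
    ((int \<Rightarrow> real) \<times> (int \<Rightarrow> real)) set" where
  "right_limits a b = {(ar, br). \<exists>m :: nat \<Rightarrow> nat. strict_mono m \<and>
     (\<forall>l. (\<lambda>j. a (nat (int (m j) + l))) \<longlonglongrightarrow> ar l \<and>
          (\<lambda>j. b (nat (int (m j) + l))) \<longlonglongrightarrow> br l)}"

end

theory Submission
  imports Defs "HOL-Complex_Analysis.Great_Picard"
begin

text \<open>
  Both spectra are described by finitely supported approximate eigenvectors. A number belongs to the
  essential spectrum of \<open>J\<close> iff \<open>J\<close> has normalized approximate eigenvectors of arbitrarily small
  error supported arbitrarily far out: otherwise there is an a priori estimate modulo a compact
  truncation, which makes the point an isolated eigenvalue; conversely, if the point is isolated, an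
  approximate eigenvector is close to a true one, whose value at site \<open>1\<close> vanishes only for the zero
  vector. Approximate eigenvectors of a right limit translate to ones of \<open>J\<close> far out. In the
  other direction, averaging over all windows of length \<open>L\<close> localizes an approximate eigenvector
  at a cost \<open>O(1/L)\<close> in the squared error, and by compactness the translated windows converge,
  together with the parameters, to an approximate eigenvector of a right limit.
\<close>

section \<open>Symmetric operators on real Hilbert spaces\<close>

text \<open>No spectral theorem is used. Spectral membership becomes an inequality: for a
  selfadjoint operator \<open>S\<close>, a point \<open>z\<close> lies in the spectrum iff
  \<open>S - z\<close> is not bounded below. Spectral points are produced from one source, the
  infimum of a quadratic form: the bottom of \<open>T^2\<close> yields a spectral point of
  \<open>T\<close> near an approximate eigenvalue, and the bottom of \<open>T^4 - d^2 T^2\<close>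
  turns a gap around 0 into the lower bound \<open>d\<close> on the range of \<open>T\<close>. This
  part works over the reals; complex scalars return later as operators commuting with
  \<open>S\<close>.

  The obstacle in passing from \<open>J\<close> to a right limit is that approximate eigenvectors
  may spread over ever longer intervals and vanish in the local limit. The right limit so obtained
  depends on the error, and its spectrum contains a point near \<open>z\<close> rather than
  \<open>z\<close> itself, which is why the argument ends in the closure of the union.\<close>

definition bounded_below :: "('a::real_normed_vector \<Rightarrow> 'b::real_normed_vector) \<Rightarrow> bool" where
  "bounded_below T \<longleftrightarrow> (\<exists>c>0. \<forall>x. c * norm x \<le> norm (T x))"

definition symmetric_op :: "('h::real_inner \<Rightarrow> 'h) \<Rightarrow> bool" where
  "symmetric_op T \<longleftrightarrow> bounded_linear T \<and> (\<forall>x y. T x \<bullet> y = x \<bullet> T y)"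

lemma symmetric_opD:
  assumes "symmetric_op T"
  shows "bounded_linear T" "T x \<bullet> y = x \<bullet> T y"
  using assms by (auto simp: symmetric_op_def)

lemma symmetric_op_shift:
  assumes "symmetric_op T"
  shows "symmetric_op (\<lambda>u. T u - r *\<^sub>R u)"
  using assms unfolding symmetric_op_def
  by (auto intro!: bounded_linear_sub bounded_linear_scaleR_const
      bounded_linear_compose[OF bounded_linear_scaleR_right] bounded_linear_ident
      simp: inner_diff_left inner_diff_right)

text \<open>Stands in for the spectral mapping theorem: polynomials in an operator are factored, and
  lower bounds for the factors multiply.\<close>

lemma bounded_below_comp:
  assumes "bounded_below f" "bounded_below g"
  shows "bounded_below (\<lambda>x. f (g x))"
proof -
  obtain c d where c: "c > 0" "\<And>x. c * norm x \<le> norm (f x)" and d: "d > 0" "\<And>x. d * norm x \<le> norm (g x)"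
    using assms unfolding bounded_below_def by metis
  have "c * d * norm x \<le> norm (f (g x))" for x
    using mult_left_mono[OF d(2)[of x] less_imp_le[OF c(1)]] c(2)[of "g x"] by (simp add: mult.assoc)
  then show ?thesis unfolding bounded_below_def using c(1) d(1) by (meson mult_pos_pos)
qed

lemma not_bounded_below_obtain:
  assumes "\<not> bounded_below T" "bounded_linear T" "e > 0"
  obtains u where "norm u = 1" "norm (T u) < e"
proof -
  interpret bounded_linear T by fact
  obtain x where x: "norm (T x) < e * norm x"
    using assms(1,3) unfolding bounded_below_def by (meson not_le)
  then have x0: "x \<noteq> 0" by (auto simp: zero)
  have "norm (T ((1 / norm x) *\<^sub>R x)) = norm (T x) / norm x"
    by (simp add: scaleR)
  also have "\<dots> < e" using x x0 by (simp add: field_simps)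
  finally show ?thesis using that[of "(1 / norm x) *\<^sub>R x"] x0 by simp
qed

lemma coercive_bounded_below:
  assumes "c > 0" "\<And>x. c * (norm x)\<^sup>2 \<le> A x \<bullet> x"
  shows "bounded_below A"
proof -
  have "c * norm x \<le> norm (A x)" for x
  proof (cases "x = 0")
    case False
    have "c * (norm x)\<^sup>2 \<le> norm (A x) * norm x"
      using assms(2)[of x] norm_cauchy_schwarz[of "A x" x] by linarith
    then show ?thesis using False by (simp add: power2_eq_square)
  qed simp
  then show ?thesis using assms(1) unfolding bounded_below_def by blast
qed

text \<open>Lax-Milgram by contraction: a solution is a fixed point of
  \<open>x - t (A x - y)\<close>. The subspace \<open>S\<close> is the whole space when resolvents
  are built and the closed range of an operator when its kernel is split off.\<close>

lemma coercive_surjective: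
  fixes A :: "'h::{real_inner,complete_space} \<Rightarrow> 'h"
  assumes A: "bounded_linear A" and S: "closed S" "subspace S" "A ` S \<subseteq> S"
    and c: "c > 0" "\<And>x. x \<in> S \<Longrightarrow> c * (norm x)\<^sup>2 \<le> A x \<bullet> x" and y: "y \<in> S"
  shows "\<exists>x\<in>S. A x = y"
proof -
  interpret bounded_linear A by fact
  obtain M0 where M0: "\<And>x. norm (A x) \<le> norm x * M0" using bounded by blast
  \<comment> \<open>Taking \<open>M\<close> at least \<open>c\<close> keeps
    \<open>1 - c^2 / M^2\<close> nonnegative, so that \<open>q\<close> below is a genuine square
    root.\<close>
  define M where "M = max M0 c"
  have M: "norm (A x) \<le> M * norm x" for x
    using M0[of x] mult_left_mono[of M0 M "norm x"] unfolding M_def by (simp add: mult.commute)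
  have M0': "M > 0" "c \<le> M" using c(1) by (auto simp: M_def)
  \<comment> \<open>This \<open>t\<close> minimizes \<open>1 - 2 t c + t^2 M^2\<close>, the bound
    for the squared contraction factor; the minimum is \<open>q^2\<close>.\<close>
  define t where "t = c / M\<^sup>2"
  define q where "q = sqrt (1 - c\<^sup>2 / M\<^sup>2)"
  have cM: "c\<^sup>2 / M\<^sup>2 \<le> 1" using M0' c(1) by (simp add: power_mono)
  have q: "0 \<le> q" "q < 1" using cM c(1) M0' by (auto simp: q_def real_sqrt_lt_1_iff)
  have t: "t > 0" using c(1) M0' by (simp add: t_def)
  have contr: "norm (x - t *\<^sub>R A x) \<le> q * norm x" if "x \<in> S" for x
  proof -
    have "(norm (x - t *\<^sub>R A x))\<^sup>2 = (norm x)\<^sup>2 - 2 * t * (A x \<bullet> x) + t\<^sup>2 * (norm (A x))\<^sup>2"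
      unfolding power2_norm_eq_inner by (simp add: inner_diff_left inner_diff_right inner_commute power2_eq_square algebra_simps)
    also have "\<dots> \<le> (norm x)\<^sup>2 - 2 * t * (c * (norm x)\<^sup>2) + t\<^sup>2 * (M * norm x)\<^sup>2"
    proof -
      have "t * (c * (norm x)\<^sup>2) \<le> t * (A x \<bullet> x)" using c(2)[OF that] t by simp
      moreover have "t\<^sup>2 * (norm (A x))\<^sup>2 \<le> t\<^sup>2 * (M * norm x)\<^sup>2"
        by (intro mult_left_mono power_mono M) auto
      ultimately show ?thesis by linarith
    qed
    also have "\<dots> = (1 - c\<^sup>2 / M\<^sup>2) * (norm x)\<^sup>2"
      using M0' by (simp add: t_def power2_eq_square field_simps)
    also have "\<dots> = (q * norm x)\<^sup>2" using cM by (simp add: q_def power_mult_distrib)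
    finally show ?thesis by (rule power2_le_imp_le) (simp add: q)
  qed
  define f where "f x = x - t *\<^sub>R (A x - y)" for x
  have "\<exists>!x\<in>S. f x = x"
  proof (rule Banach_fix[where c = q])
    show "complete S" using S(1) by (simp add: complete_eq_closed)
    show "S \<noteq> {}" using y by auto
    show "f ` S \<subseteq> S"
      using S(2,3) y unfolding f_def by (auto intro!: subspace_diff subspace_scale)
    fix x x' assume "x \<in> S" "x' \<in> S"
    have "f x - f x' = (x - x') - t *\<^sub>R A (x - x')"
      by (simp add: f_def diff algebra_simps)
    then show "dist (f x) (f x') \<le> q * dist x x'"
      using contr[of "x - x'"] S(2) \<open>x \<in> S\<close> \<open>x' \<in> S\<close> by (simp add: dist_norm subspace_diff)
  qed (use q in auto)
  then show ?thesis using t by (auto simp: f_def)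
qed

text \<open>A nonnegative symmetric \<open>B\<close> satisfies \<open>\<parallel>B u\<parallel>\<^sup>2 \<le> M (B u \<bullet> u)\<close>, so near-minimizers of the
  quadratic form are approximate eigenvectors.\<close>

lemma symmetric_op_bottom:
  fixes A :: "'h::real_inner \<Rightarrow> 'h"
  assumes A: "symmetric_op A" and v: "v \<noteq> (0::'h)"
  obtains m where "\<And>u. m * (norm u)\<^sup>2 \<le> A u \<bullet> u" "\<not> bounded_below (\<lambda>u. A u - m *\<^sub>R u)"
proof -
  interpret bounded_linear A using A by (rule symmetric_opD)
  obtain M0 where M0: "\<And>x. norm (A x) \<le> norm x * M0" using bounded by blast
  define Q where "Q = (\<lambda>u. A u \<bullet> u) ` {u. norm u = 1}"
  have lowQ: "- M0 \<le> A u \<bullet> u" if "norm u = 1" for u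
    using Cauchy_Schwarz_ineq2[of "A u" u] M0[of u] that by simp
  have bdd: "bdd_below Q" using lowQ unfolding Q_def by (intro bdd_belowI2) auto
  have "(1 / norm v) *\<^sub>R v \<in> {u. norm u = 1}" using v by simp
  then have ne: "Q \<noteq> {}" unfolding Q_def by blast
  define m where "m = Inf Q"
  have m1: "m \<le> A u \<bullet> u" if "norm u = 1" for u
    unfolding m_def using that bdd by (intro cInf_lower) (auto simp: Q_def)
  have m: "m * (norm u)\<^sup>2 \<le> A u \<bullet> u" for u
  proof (cases "u = 0")
    case False
    have "m \<le> A ((1 / norm u) *\<^sub>R u) \<bullet> ((1 / norm u) *\<^sub>R u)" using False by (intro m1) simp
    also have "\<dots> = (A u \<bullet> u) / (norm u)\<^sup>2" by (simp add: scaleR power2_eq_square)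
    finally show ?thesis using False by (simp add: field_simps)
  qed simp
  define B where "B u = A u - m *\<^sub>R u" for u
  have symB: "symmetric_op B" using symmetric_op_shift[OF A] unfolding B_def[abs_def] .
  have posB: "B u \<bullet> u \<ge> 0" for u
    using m[of u] by (simp add: B_def inner_diff_left power2_norm_eq_inner)
  interpret B: bounded_linear B using symB by (rule symmetric_opD)
  obtain M where M: "M > 0" "\<And>x. norm (B x) \<le> norm x * M" using B.pos_bounded by blast
  have key: "(norm (B u))\<^sup>2 \<le> M * (B u \<bullet> u)" for u
  proof -
    \<comment> \<open>A gradient step of length \<open>1 / M\<close> for the form of
      \<open>B\<close>; its nonnegativity at the new point is the claimed inequality.\<close>
    let ?w = "u - (1 / M) *\<^sub>R B u"
    have "B (B u) \<bullet> B u \<le> norm (B (B u)) * norm (B u)" by (rule norm_cauchy_schwarz)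
    also have "\<dots> \<le> (norm (B u) * M) * norm (B u)" by (intro mult_right_mono M) auto
    finally have 1: "B (B u) \<bullet> B u \<le> M * (norm (B u))\<^sup>2" by (simp add: power2_eq_square mult_ac)
    have "0 \<le> B ?w \<bullet> ?w" by (rule posB)
    also have "\<dots> = B u \<bullet> u - (2 / M) * (norm (B u))\<^sup>2 + (B (B u) \<bullet> B u) / M\<^sup>2"
      using symmetric_opD(2)[OF symB, of "B u" u]
      by (simp add: B.diff B.scaleR inner_diff_left inner_diff_right dot_square_norm inner_commute power2_eq_square[of M])
    also have "\<dots> \<le> B u \<bullet> u - (2 / M) * (norm (B u))\<^sup>2 + (M * (norm (B u))\<^sup>2) / M\<^sup>2"
      using 1 by (intro add_left_mono divide_right_mono) auto
    also have "\<dots> = B u \<bullet> u - (norm (B u))\<^sup>2 / M"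
      using M(1) by (simp add: power2_eq_square field_simps)
    finally show ?thesis using M(1) by (simp add: field_simps)
  qed
  have "\<not> bounded_below B"
  proof
    assume "bounded_below B"
    then obtain c where c: "c > 0" "\<And>x. c * norm x \<le> norm (B x)" unfolding bounded_below_def by blast
    have "c\<^sup>2 / M + m > Inf Q" using c(1) M(1) by (simp add: m_def)
    then obtain u where u: "norm u = 1" "A u \<bullet> u < c\<^sup>2 / M + m"
      using cInf_lessD[OF ne] unfolding Q_def by blast
    have "B u \<bullet> u < c\<^sup>2 / M"
      using u by (simp add: B_def inner_diff_left power2_norm_eq_inner[symmetric])
    then have "M * (B u \<bullet> u) < c\<^sup>2" using M(1) by (simp add: field_simps)
    then have "(norm (B u))\<^sup>2 < c\<^sup>2" using key[of u] by linarith
    moreover have "c\<^sup>2 \<le> (norm (B u))\<^sup>2" using c(2)[of u] u c(1) by (intro power_mono) auto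
    ultimately show False by simp
  qed
  then show ?thesis unfolding B_def[abs_def] by (rule that[OF m])
qed

text \<open>Factor \<open>T^2 - s^2 = (T - s) (T + s)\<close>: if both factors were bounded below,
  so would be the product.\<close>

lemma not_bounded_below_square:
  fixes T :: "'h::real_normed_vector \<Rightarrow> 'h"
  assumes "bounded_linear T" "\<not> bounded_below (\<lambda>u. T (T u) - s\<^sup>2 *\<^sub>R u)"
  shows "\<exists>t\<in>{s, - s}. \<not> bounded_below (\<lambda>u. T u - t *\<^sub>R u)"
proof (rule ccontr)
  interpret bounded_linear T by fact
  assume "\<not> ?thesis"
  then have "bounded_below (\<lambda>u. T u - s *\<^sub>R u)" "bounded_below (\<lambda>u. T u - (- s) *\<^sub>R u)" by auto
  then have "bounded_below (\<lambda>u. T (T u - (- s) *\<^sub>R u) - s *\<^sub>R (T u - (- s) *\<^sub>R u))"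
    by (rule bounded_below_comp)
  also have "(\<lambda>u. T (T u - (- s) *\<^sub>R u) - s *\<^sub>R (T u - (- s) *\<^sub>R u)) = (\<lambda>u. T (T u) - s\<^sup>2 *\<^sub>R u)"
    by (simp add: add scaleR diff algebra_simps power2_eq_square)
  finally show False using assms(2) by simp
qed

text \<open>Testing the form of \<open>T^2\<close> with \<open>v\<close> shows that its bottom
  \<open>m\<close> is at most \<open>e^2\<close>, and one of the two square roots of
  \<open>m\<close> is then a spectral point of \<open>T\<close>.\<close>

lemma approximate_eigenvalue_near:
  fixes T :: "'h::real_inner \<Rightarrow> 'h"
  assumes T: "symmetric_op T" and v: "v \<noteq> 0" "norm (T v) \<le> e * norm v"
  shows "\<exists>t. \<bar>t\<bar> \<le> e \<and> \<not> bounded_below (\<lambda>u. T u - t *\<^sub>R u)"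
proof -
  interpret bounded_linear T using T by (rule symmetric_opD)
  have sym: "T x \<bullet> y = x \<bullet> T y" for x y using symmetric_opD(2)[OF T] .
  have "symmetric_op (\<lambda>u. T (T u))"
    unfolding symmetric_op_def using bounded_linear_compose[OF bounded_linear bounded_linear] sym by auto
  then obtain m where m: "\<And>u. m * (norm u)\<^sup>2 \<le> T (T u) \<bullet> u" "\<not> bounded_below (\<lambda>u. T (T u) - m *\<^sub>R u)"
    by (rule symmetric_op_bottom[OF _ v(1)]) blast
  have TT: "T (T u) \<bullet> u = (norm (T u))\<^sup>2" for u by (simp add: sym power2_norm_eq_inner)
  have "m \<ge> 0"
  proof (rule ccontr)
    assume "\<not> m \<ge> 0"
    then have "bounded_below (\<lambda>u. T (T u) - m *\<^sub>R u)"
      by (intro coercive_bounded_below[of "- m"]) (auto simp: inner_diff_left TT power2_norm_eq_inner[symmetric])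
    then show False using m(2) by simp
  qed
  then have "\<not> bounded_below (\<lambda>u. T (T u) - (sqrt m)\<^sup>2 *\<^sub>R u)" using m(2) by simp
  from not_bounded_below_square[OF bounded_linear this]
  obtain t where t: "t \<in> {sqrt m, - sqrt m}" "\<not> bounded_below (\<lambda>u. T u - t *\<^sub>R u)" by blast
  have e: "e \<ge> 0" using v by (metis norm_ge_zero norm_le_zero_iff order_trans zero_le_mult_iff not_le)
  have "m * (norm v)\<^sup>2 \<le> (e * norm v)\<^sup>2"
    using m(1)[of v] v(2) unfolding TT by (smt (verit) norm_ge_zero power_mono)
  then have "m \<le> e\<^sup>2" using v(1) by (simp add: power_mult_distrib)
  then have "sqrt m \<le> e" using e real_le_lsqrt by blast
  then have "\<bar>t\<bar> \<le> e" using t(1) \<open>m \<ge> 0\<close> by auto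
  then show ?thesis using t(2) by blast
qed

section \<open>Spectral gaps and isolated eigenvalues\<close>

lemma subspace_closure:
  fixes S :: "'a::real_normed_vector set"
  assumes "subspace S"
  shows "subspace (closure S)"
proof (rule subspaceI)
  show "0 \<in> closure S" using subspace_0[OF assms] closure_subset by blast
next
  fix x y assume "x \<in> closure S" "y \<in> closure S"
  then obtain f g where "\<forall>n. f n \<in> S" "f \<longlonglongrightarrow> x" "\<forall>n. g n \<in> S" "g \<longlonglongrightarrow> y"
    unfolding closure_sequential by blast
  then show "x + y \<in> closure S"
    unfolding closure_sequential using subspace_add[OF assms] tendsto_add by (intro exI[of _ "\<lambda>n. f n + g n"]) auto
next
  fix c :: real and x assume "x \<in> closure S"
  then obtain f where "\<forall>n. f n \<in> S" "f \<longlonglongrightarrow> x" unfolding closure_sequential by blast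
  then show "c *\<^sub>R x \<in> closure S"
    unfolding closure_sequential using subspace_scale[OF assms] tendsto_scaleR[OF tendsto_const]
    by (intro exI[of _ "\<lambda>n. c *\<^sub>R f n"]) auto
qed

text \<open>The polynomial \<open>t\<^sup>4 - d\<^sup>2 t\<^sup>2\<close> is nonnegative on the spectrum; if the bottom of
  \<open>T\<^sup>4 - d\<^sup>2 T\<^sup>2\<close> were \<open>-n < 0\<close>, the roots of \<open>t\<^sup>4 - d\<^sup>2 t\<^sup>2 + n\<close> would be nonreal or would lie in the gap.\<close>

lemma spectral_gap_on_range:
  fixes T :: "'h::real_inner \<Rightarrow> 'h"
  assumes T: "symmetric_op T" and d: "d > 0"
    and gap: "\<And>t. 0 < \<bar>t\<bar> \<Longrightarrow> \<bar>t\<bar> < d \<Longrightarrow> bounded_below (\<lambda>u. T u - t *\<^sub>R u)"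
  shows "d * norm (T u) \<le> norm (T (T u))"
proof (cases "u = 0")
  case False
  interpret bounded_linear T using T by (rule symmetric_opD)
  have sym: "T x \<bullet> y = x \<bullet> T y" for x y using symmetric_opD(2)[OF T] .
  have T2: "bounded_linear (\<lambda>u. T (T u))" using bounded_linear_compose[OF bounded_linear bounded_linear] .
  define A where "A u = T (T (T (T u))) - d\<^sup>2 *\<^sub>R T (T u)" for u
  have blA: "bounded_linear A" unfolding A_def
    by (intro bounded_linear_sub bounded_linear_compose[OF bounded_linear_scaleR_right] T2
        bounded_linear_compose[OF T2 T2])
  then have "symmetric_op A"
    unfolding symmetric_op_def by (auto simp: A_def inner_diff_left inner_diff_right sym)
  then obtain m where m: "\<And>u. m * (norm u)\<^sup>2 \<le> A u \<bullet> u" "\<not> bounded_below (\<lambda>u. A u - m *\<^sub>R u)"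
    by (rule symmetric_op_bottom[OF _ False]) blast
  have AA: "A u \<bullet> u = (norm (T (T u)))\<^sup>2 - d\<^sup>2 * (norm (T u))\<^sup>2" for u
    by (simp add: A_def inner_diff_left sym power2_norm_eq_inner)
  have "m \<ge> 0"
  proof (rule ccontr)
    assume "\<not> m \<ge> 0"
    define n where "n = - m"
    have n: "n > 0" using \<open>\<not> m \<ge> 0\<close> by (simp add: n_def)
    show False
    \<comment> \<open>The sign of the discriminant of \<open>x^2 - d^2 x + n\<close>, where
      \<open>x\<close> stands for \<open>T^2\<close>. If it is negative, completing the square gives
      the coercivity constant \<open>n - d^4 / 4\<close>.\<close>
    proof (cases "4 * n > d^4")
      case True
      have "(n - d^4 / 4) * (norm u)\<^sup>2 \<le> (A u - m *\<^sub>R u) \<bullet> u" for u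
      proof -
        have "(norm (T u))\<^sup>2 = T (T u) \<bullet> u" by (simp add: sym power2_norm_eq_inner)
        also have "\<dots> \<le> norm (T (T u)) * norm u" by (rule norm_cauchy_schwarz)
        finally have "d\<^sup>2 * (norm (T u))\<^sup>2 \<le> d\<^sup>2 * (norm (T (T u)) * norm u)" by (intro mult_left_mono) auto
        moreover have "0 \<le> (norm (T (T u)) - d\<^sup>2 / 2 * norm u)\<^sup>2" by simp
        ultimately show ?thesis
          by (simp add: inner_diff_left AA n_def power2_norm_eq_inner[symmetric] power2_diff
              power_mult_distrib algebra_simps power_divide flip: power_mult)
      qed
      then have "bounded_below (\<lambda>u. A u - m *\<^sub>R u)"
        using True by (intro coercive_bounded_below[of "n - d^4/4"]) auto
      then show False using m(2) by simp
    next
      case False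
      \<comment> \<open>The roots in \<open>x\<close> are \<open>d^2 / 2 + s\<close> and
        \<open>d^2 / 2 - s\<close>. Since \<open>n > 0\<close>, both lie strictly between 0 and
        \<open>d^2\<close>, so \<open>p\<close>, \<open>-p\<close>, \<open>q\<close>,
        \<open>-q\<close> all fall into the gap and the four linear factors are bounded
        below.\<close>
      define s where "s = sqrt (d^4 / 4 - n)"
      have s2: "s\<^sup>2 = d^4 / 4 - n" using False by (simp add: s_def)
      have s0: "s \<ge> 0" using False by (simp add: s_def)
      have "s\<^sup>2 < (d\<^sup>2 / 2)\<^sup>2" using n unfolding s2 by (simp add: power_divide flip: power_mult)
      then have sd: "s < d\<^sup>2 / 2" by (rule power2_less_imp_less) simp
      define p q where "p = sqrt (d\<^sup>2 / 2 + s)" and "q = sqrt (d\<^sup>2 / 2 - s)"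
      have p2: "p\<^sup>2 = d\<^sup>2 / 2 + s" and q2: "q\<^sup>2 = d\<^sup>2 / 2 - s" using s0 sd by (auto simp: p_def q_def)
      have pq0: "p > 0" "q > 0"
        using s0 sd d unfolding p_def q_def by (auto intro: add_pos_nonneg)
      have "p\<^sup>2 < d\<^sup>2" "q\<^sup>2 < d\<^sup>2" unfolding p2 q2 using s0 sd d by auto
      then have "p < d" "q < d" using d power2_less_imp_less[of _ d] by auto
      then have "bounded_below (\<lambda>u. T (T u) - p\<^sup>2 *\<^sub>R u)" "bounded_below (\<lambda>u. T (T u) - q\<^sup>2 *\<^sub>R u)"
        using not_bounded_below_square[OF bounded_linear, of p] not_bounded_below_square[OF bounded_linear, of q]
          gap[of p] gap[of "- p"] gap[of q] gap[of "- q"] pq0 by auto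
      from bounded_below_comp[OF this]
      have "bounded_below (\<lambda>u. T (T (T (T u) - q\<^sup>2 *\<^sub>R u)) - p\<^sup>2 *\<^sub>R (T (T u) - q\<^sup>2 *\<^sub>R u))" .
      also have "(\<lambda>u. T (T (T (T u) - q\<^sup>2 *\<^sub>R u)) - p\<^sup>2 *\<^sub>R (T (T u) - q\<^sup>2 *\<^sub>R u)) = (\<lambda>u. A u - m *\<^sub>R u)"
      proof
        fix u
        have *: "p\<^sup>2 * q\<^sup>2 = n" "p\<^sup>2 + q\<^sup>2 = d\<^sup>2"
          using s2 unfolding p2 q2 by (simp_all add: algebra_simps power2_eq_square power4_eq_xxxx)
        have "T (T (T (T u) - q\<^sup>2 *\<^sub>R u)) - p\<^sup>2 *\<^sub>R (T (T u) - q\<^sup>2 *\<^sub>R u)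
            = T (T (T (T u))) - (p\<^sup>2 + q\<^sup>2) *\<^sub>R T (T u) + (p\<^sup>2 * q\<^sup>2) *\<^sub>R u"
          by (simp add: diff scaleR scaleR_diff_right scaleR_add_left)
        then show "T (T (T (T u) - q\<^sup>2 *\<^sub>R u)) - p\<^sup>2 *\<^sub>R (T (T u) - q\<^sup>2 *\<^sub>R u) = A u - m *\<^sub>R u"
          unfolding * by (simp add: A_def n_def)
      qed
      finally show False using m(2) by simp
    qed
  qed
  then have "0 \<le> A u \<bullet> u" using m(1)[of u] by (meson mult_nonneg_nonneg order_trans zero_le_power2)
  then have "(d * norm (T u))\<^sup>2 \<le> (norm (T (T u)))\<^sup>2" by (simp add: AA power_mult_distrib)
  then show ?thesis by (rule power2_le_imp_le) simp
qed (use symmetric_opD(1)[OF T] in \<open>simp add: linear_0 bounded_linear.linear\<close>)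

text \<open>The gap bound extends by continuity to the closed range \<open>S\<close>, where it makes
  \<open>T^2\<close> coercive. Solving \<open>T^2 h = T^2 u\<close> in \<open>S\<close> yields the
  component \<open>h\<close> of \<open>u\<close> in \<open>S\<close>. The gap bound for
  \<open>T (u - h)\<close>, a vector of the range, shows that \<open>u - h\<close> is in the kernel,
  and on \<open>h\<close> it gives the distance.\<close>

lemma distance_to_kernel_of_isolated:
  fixes T :: "'h::{real_inner,complete_space} \<Rightarrow> 'h"
  assumes T: "symmetric_op T" and d: "d > 0"
    and gap: "\<And>t. 0 < \<bar>t\<bar> \<Longrightarrow> \<bar>t\<bar> < d \<Longrightarrow> bounded_below (\<lambda>u. T u - t *\<^sub>R u)"
  shows "\<exists>e. T e = 0 \<and> norm (u - e) \<le> norm (T u) / d"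
proof -
  interpret bounded_linear T using T by (rule symmetric_opD)
  have sym: "T x \<bullet> y = x \<bullet> T y" for x y using symmetric_opD(2)[OF T] .
  have T2: "bounded_linear (\<lambda>u. T (T u))" using bounded_linear_compose[OF bounded_linear bounded_linear] .
  have lin: "linear T" by (rule linear)
  define S where "S = closure (range T)"
  have gapT: "d * norm (T u) \<le> norm (T (T u))" for u by (rule spectral_gap_on_range[OF assms])
  have gapS: "d * norm w \<le> norm (T w)" if "w \<in> S" for w
  proof -
    have "closed {w. d * norm w \<le> norm (T w)}"
      by (intro closed_Collect_le continuous_intros linear_continuous_on bounded_linear)
    moreover have "range T \<subseteq> {w. d * norm w \<le> norm (T w)}" using gapT by auto
    ultimately have "S \<subseteq> {w. d * norm w \<le> norm (T w)}" unfolding S_def by (rule closure_minimal[rotated])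
    then show ?thesis using that by blast
  qed
  have mapS: "T x \<in> S" for x unfolding S_def by (rule closure_subset[THEN subsetD]) simp
  have "\<exists>x\<in>S. T (T x) = T (T u)"
  proof (rule coercive_surjective[OF T2])
    show "subspace S" unfolding S_def by (intro subspace_closure linear_subspace_image[OF lin] subspace_UNIV)
    show "d\<^sup>2 > 0" using d by simp
    fix x assume "x \<in> S"
    then have "(d * norm x)\<^sup>2 \<le> (norm (T x))\<^sup>2" using gapS d by (intro power_mono) auto
    then show "d\<^sup>2 * (norm x)\<^sup>2 \<le> T (T x) \<bullet> x" by (simp add: sym power2_norm_eq_inner power_mult_distrib)
  qed (auto simp: S_def mapS[unfolded S_def])
  then obtain h where h: "h \<in> S" "T (T h) = T (T u)" by blast
  have "d * norm (T (u - h)) \<le> norm (T (T (u - h)))" by (rule gapT)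
  also have "T (T (u - h)) = 0" using h by (simp add: diff)
  finally have 0: "T (u - h) = 0" using d by (simp add: mult_le_0_iff)
  have "d * norm h \<le> norm (T h)" using gapS h by blast
  also have "T h = T u" using 0 by (simp add: diff)
  finally have "norm (u - (u - h)) \<le> norm (T u) / d" using d by (simp add: field_simps)
  then show ?thesis using 0 by blast
qed

text \<open>The hypothesis on \<open>P\<close> is the sequential form of compactness.\<close>

lemma approximate_kernel_subsequence:
  fixes T :: "'h::{real_normed_vector,complete_space} \<Rightarrow> 'h" and P :: "'h \<Rightarrow> 'h"
  assumes T: "bounded_linear T" and P: "bounded_linear P"
    and comp: "\<And>u. (\<And>k. norm (u k) = 1) \<Longrightarrow> \<exists>s. strict_mono (s::nat \<Rightarrow> nat) \<and> convergent (\<lambda>k. P (u (s k)))"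
    and est: "\<And>u. norm u \<le> C * (norm (T u) + norm (P u))"
    and u: "\<And>k. norm (u k) = 1" "(\<lambda>k. T (u k)) \<longlonglongrightarrow> 0"
  obtains s w where "strict_mono (s::nat \<Rightarrow> nat)" "(\<lambda>k. u (s k)) \<longlonglongrightarrow> w" "norm w = 1" "T w = 0"
proof -
  interpret T: bounded_linear T by fact
  interpret P: bounded_linear P by fact
  obtain s where s: "strict_mono (s::nat \<Rightarrow> nat)" "convergent (\<lambda>k. P (u (s k)))" using comp[of u, OF u(1)] by auto
  have Ts: "(\<lambda>k. T (u (s k))) \<longlonglongrightarrow> 0"
    using LIMSEQ_subseq_LIMSEQ[OF u(2) s(1)] by (simp add: o_def)
  define D where "D = max C 1"
  have D: "D > 0" "C \<le> D" by (auto simp: D_def)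
  have est': "norm x \<le> D * (norm (T x) + norm (P x))" for x
    using est[of x] mult_right_mono[OF D(2), of "norm (T x) + norm (P x)"] by simp
  \<comment> \<open>The estimate is applied to differences of the \<open>u (s k)\<close>: their
    images under \<open>T\<close> and under \<open>P\<close> both become small.\<close>
  have "Cauchy (\<lambda>k. u (s k))"
  proof (rule CauchyI)
    fix e :: real assume e: "e > 0"
    have "Cauchy (\<lambda>k. T (u (s k)))" "Cauchy (\<lambda>k. P (u (s k)))"
      using Ts s(2) by (auto intro: LIMSEQ_imp_Cauchy convergent_Cauchy)
    then obtain M N where MN: "\<forall>m\<ge>M. \<forall>n\<ge>M. norm (T (u (s m)) - T (u (s n))) < e / (2 * D)"
      "\<forall>m\<ge>N. \<forall>n\<ge>N. norm (P (u (s m)) - P (u (s n))) < e / (2 * D)"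
      using e D(1) CauchyD[of "\<lambda>k. T (u (s k))" "e / (2 * D)"]
        CauchyD[of "\<lambda>k. P (u (s k))" "e / (2 * D)"] by auto
    then have *: "norm (T (u (s m) - u (s n))) + norm (P (u (s m) - u (s n))) < e / D"
      if "m \<ge> max M N" "n \<ge> max M N" for m n

    proof -
      have "norm (T (u (s m) - u (s n))) < e / (2 * D)" "norm (P (u (s m) - u (s n))) < e / (2 * D)"
        using that MN by (auto simp: T.diff P.diff)
      then show ?thesis using D(1) by (simp add: field_simps)
    qed
    have "norm (u (s m) - u (s n)) < e" if "m \<ge> max M N" "n \<ge> max M N" for m n
      using est'[of "u (s m) - u (s n)"] *[OF that] D(1) by (simp add: field_simps)
    then show "\<exists>M. \<forall>m\<ge>M. \<forall>n\<ge>M. norm (u (s m) - u (s n)) < e" by blast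
  qed
  then obtain w where w: "(\<lambda>k. u (s k)) \<longlonglongrightarrow> w"
    using Cauchy_convergent convergent_def by blast
  have "norm w = 1" using tendsto_norm[OF w] u(1) by (simp add: LIMSEQ_const_iff)
  moreover have "T w = 0" using T.tendsto[OF w] Ts LIMSEQ_unique by blast
  ultimately show ?thesis using that s(1) w by blast
qed

text \<open>Approximate kernel vectors subconverge to unit kernel vectors, which gives the
  eigenvalue. If spectral points \<open>t k\<close> tended to 0, their approximate eigenvectors
  would also be approximate kernel vectors and subconverge to a unit kernel vector \<open>w\<close>;
  but they are asymptotically orthogonal to \<open>w\<close>, a contradiction.\<close>

lemma isolated_eigenvalue_of_a_priori_estimate:
  fixes T :: "'h::{real_inner,complete_space} \<Rightarrow> 'h" and P :: "'h \<Rightarrow> 'h"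
  assumes T: "symmetric_op T" and P: "bounded_linear P"
    and comp: "\<And>u. (\<And>k. norm (u k) = 1) \<Longrightarrow> \<exists>s. strict_mono (s::nat \<Rightarrow> nat) \<and> convergent (\<lambda>k. P (u (s k)))"
    and est: "\<And>u. norm u \<le> C * (norm (T u) + norm (P u))"
    and nbb: "\<not> bounded_below T"
  shows "\<exists>w. w \<noteq> 0 \<and> T w = 0"
    and "\<exists>d>0. \<forall>t. 0 < \<bar>t\<bar> \<and> \<bar>t\<bar> < d \<longrightarrow> bounded_below (\<lambda>u. T u - t *\<^sub>R u)"
proof -
  note bl = symmetric_opD(1)[OF T]
  interpret bounded_linear T by (rule bl)
  have "\<exists>u. norm u = 1 \<and> norm (T u) < inverse (of_nat (Suc k))" for k
    by (rule not_bounded_below_obtain[OF nbb bl, of "inverse (of_nat (Suc k))"]) auto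
  then obtain u where u: "\<And>k. norm (u k) = 1" "\<And>k. norm (T (u k)) < inverse (of_nat (Suc k))" by metis
  have "(\<lambda>k. T (u k)) \<longlonglongrightarrow> 0"
    by (rule Lim_null_comparison[OF _ LIMSEQ_inverse_real_of_nat]) (use u(2) in \<open>auto intro!: always_eventually less_imp_le\<close>)
  from approximate_kernel_subsequence[OF bl P comp est u(1) this]
  obtain w where "norm w = 1" "T w = 0" by metis
  then show "\<exists>w. w \<noteq> 0 \<and> T w = 0" by (metis norm_zero zero_neq_one)
  show "\<exists>d>0. \<forall>t. 0 < \<bar>t\<bar> \<and> \<bar>t\<bar> < d \<longrightarrow> bounded_below (\<lambda>u. T u - t *\<^sub>R u)"
  proof (rule ccontr)
    assume neg: "\<not> ?thesis"
    \<comment> \<open>The error carries the factor \<open>\<bar>t\<bar>\<close> so that it is still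
      small after the division by \<open>t\<close> in the orthogonality estimate
      \<open>small\<close>.\<close>
    have "\<exists>t v. 0 < \<bar>t\<bar> \<and> \<bar>t\<bar> < inverse (of_nat (Suc k)) \<and> norm v = 1 \<and>
        norm (T v - t *\<^sub>R v) < \<bar>t\<bar> * inverse (of_nat (Suc k))" for k
    proof -
      obtain t where t: "0 < \<bar>t\<bar>" "\<bar>t\<bar> < inverse (of_nat (Suc k))" "\<not> bounded_below (\<lambda>u. T u - t *\<^sub>R u)"
        using neg inverse_positive_iff_positive of_nat_0_less_iff zero_less_Suc by (metis (no_types))
      show ?thesis
        by (rule not_bounded_below_obtain[OF t(3) symmetric_opD(1)[OF symmetric_op_shift[OF T]],
              of "\<bar>t\<bar> * inverse (of_nat (Suc k))"]) (use t in auto)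
    qed
    then obtain t v where t: "\<And>k. 0 < \<bar>t k\<bar>" "\<And>k. \<bar>t k\<bar> < inverse (of_nat (Suc k))"
      and v: "\<And>k. norm (v k) = 1"
        "\<And>k. norm (T (v k) - t k *\<^sub>R v k) < \<bar>t k\<bar> * inverse (of_nat (Suc k))"
      by metis
    have Tv: "norm (T (v k)) \<le> 2 * inverse (of_nat (Suc k))" for k
    proof -
      have "norm (T (v k)) \<le> norm (T (v k) - t k *\<^sub>R v k) + norm (t k *\<^sub>R v k)" using norm_triangle_sub[of "T (v k)" "t k *\<^sub>R v k"] by simp
      also have "\<dots> \<le> \<bar>t k\<bar> * inverse (of_nat (Suc k)) + \<bar>t k\<bar>" using v(1)[of k] v(2)[of k] by simp
      also have "\<bar>t k\<bar> * inverse (of_nat (Suc k)) \<le> \<bar>t k\<bar> * 1"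
        by (intro mult_left_mono) (auto simp: field_simps)
      finally show ?thesis using t(2)[of k] by linarith
    qed
    have lim2: "(\<lambda>k. 2 * inverse (real (Suc k))) \<longlonglongrightarrow> 0"
      using tendsto_mult[OF tendsto_const LIMSEQ_inverse_real_of_nat, of 2] by simp
    have "(\<lambda>k. T (v k)) \<longlonglongrightarrow> 0"
      by (rule Lim_null_comparison[OF _ lim2]) (use Tv in \<open>auto intro!: always_eventually\<close>)
    from approximate_kernel_subsequence[OF bl P comp est v(1) this]
    obtain s w where s: "strict_mono (s::nat \<Rightarrow> nat)" "(\<lambda>k. v (s k)) \<longlonglongrightarrow> w" "norm w = 1" "T w = 0" by metis
    have small: "\<bar>v k \<bullet> w\<bar> \<le> inverse (of_nat (Suc k))" for k
    proof -
      have "t k * (v k \<bullet> w) = - ((T (v k) - t k *\<^sub>R v k) \<bullet> w)"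
        using symmetric_opD(2)[OF T, of "v k" w] s(4) by (simp add: inner_diff_left)
      then have "\<bar>t k\<bar> * \<bar>v k \<bullet> w\<bar> = \<bar>(T (v k) - t k *\<^sub>R v k) \<bullet> w\<bar>"
        by (metis abs_minus_cancel abs_mult)
      also have "\<dots> \<le> norm (T (v k) - t k *\<^sub>R v k)"
        using Cauchy_Schwarz_ineq2[of "T (v k) - t k *\<^sub>R v k" w] s(3) by simp
      also have "\<dots> \<le> \<bar>t k\<bar> * inverse (of_nat (Suc k))" using v(2)[of k] by simp
      finally show ?thesis using t(1)[of k] by simp
    qed
    have "(\<lambda>k. v k \<bullet> w) \<longlonglongrightarrow> 0"
      by (rule Lim_null_comparison[OF _ LIMSEQ_inverse_real_of_nat]) (use small in \<open>auto intro!: always_eventually\<close>)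
    from LIMSEQ_subseq_LIMSEQ[OF this s(1)] have "(\<lambda>k. v (s k) \<bullet> w) \<longlonglongrightarrow> 0" by (simp add: o_def)
    moreover have "(\<lambda>k. v (s k) \<bullet> w) \<longlonglongrightarrow> w \<bullet> w" by (intro tendsto_inner s(2) tendsto_const)
    ultimately have "w \<bullet> w = 0" using LIMSEQ_unique by blast
    then show False using s(3) by simp
  qed
qed

section \<open>The Hilbert space of square-summable families\<close>

lemma ell2_UNIV_iff: "u \<in> ell2 UNIV \<longleftrightarrow> (\<lambda>i. (cmod (u i))\<^sup>2) summable_on UNIV"
  by (simp add: ell2_def)

lemma ell2_UNIV_add:
  assumes "u \<in> ell2 UNIV" "v \<in> ell2 UNIV"
  shows "(\<lambda>i. u i + v i) \<in> ell2 UNIV"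
  unfolding ell2_UNIV_iff
proof (rule summable_on_comparison_test)
  show "(\<lambda>i. 2 * (cmod (u i))\<^sup>2 + 2 * (cmod (v i))\<^sup>2) summable_on UNIV"
    using assms unfolding ell2_UNIV_iff by (intro summable_on_add summable_on_cmult_right)
  show "(cmod (u i + v i))\<^sup>2 \<le> 2 * (cmod (u i))\<^sup>2 + 2 * (cmod (v i))\<^sup>2" for i
    using norm_triangle_ineq[of "u i" "v i"] sum_squares_bound[of "cmod (u i)" "cmod (v i)"]
    by (smt (verit) norm_ge_zero power2_sum power_mono)
qed simp

lemma ell2_UNIV_dominated:
  assumes "u \<in> ell2 UNIV" "\<And>i. cmod (v i) \<le> C * cmod (u i)"
  shows "v \<in> ell2 UNIV"
  unfolding ell2_UNIV_iff
proof (rule summable_on_comparison_test)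
  show "(\<lambda>i. C\<^sup>2 * (cmod (u i))\<^sup>2) summable_on UNIV"
    using assms unfolding ell2_UNIV_iff by (intro summable_on_cmult_right)
  show "(cmod (v i))\<^sup>2 \<le> C\<^sup>2 * (cmod (u i))\<^sup>2" for i
    using power_mono[OF assms(2) norm_ge_zero, of i 2] by (simp add: power_mult_distrib)
qed simp

lemma ell2_UNIV_inner_summable:
  assumes "u \<in> ell2 UNIV" "v \<in> ell2 UNIV"
  shows "(\<lambda>i. u i \<bullet> v i) summable_on UNIV"
proof (rule abs_summable_summable, rule summable_on_comparison_test)
  show "(\<lambda>i. (cmod (u i))\<^sup>2 + (cmod (v i))\<^sup>2) summable_on UNIV"
    using assms unfolding ell2_UNIV_iff by (intro summable_on_add)
  show "norm (u i \<bullet> v i) \<le> (cmod (u i))\<^sup>2 + (cmod (v i))\<^sup>2" for i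
    using Cauchy_Schwarz_ineq2[of "u i" "v i"] sum_squares_bound[of "cmod (u i)" "cmod (v i)"]
      mult_nonneg_nonneg[OF norm_ge_zero norm_ge_zero, of "u i" "v i"] by simp
qed simp

text \<open>A type is introduced so that the preceding results on type classes apply. It is made a
  real vector space only; complex multiplication is added as the operator
  \<open>cscale\<close>.\<close>

typedef 'i l2 = "ell2 (UNIV :: 'i set)" morphisms coord Abs_l2
  by (rule exI[of _ "\<lambda>_. 0"]) (simp add: ell2_UNIV_iff)

setup_lifting type_definition_l2

lemma l2_eqI: "(\<And>i. coord u i = coord v i) \<Longrightarrow> u = v"
  by (metis coord_inject ext)

instantiation l2 :: (type) real_vector
begin

lift_definition zero_l2 :: "'a l2" is "\<lambda>_. 0" by (simp add: ell2_UNIV_iff)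
lift_definition plus_l2 :: "'a l2 \<Rightarrow> 'a l2 \<Rightarrow> 'a l2" is "\<lambda>u v i. u i + v i" by (rule ell2_UNIV_add)
lift_definition uminus_l2 :: "'a l2 \<Rightarrow> 'a l2" is "\<lambda>u i. - u i" by (simp add: ell2_UNIV_iff)
definition minus_l2 :: "'a l2 \<Rightarrow> 'a l2 \<Rightarrow> 'a l2" where "minus_l2 u v = u + - v"
lift_definition scaleR_l2 :: "real \<Rightarrow> 'a l2 \<Rightarrow> 'a l2" is "\<lambda>r u i. r *\<^sub>R u i"
  by (rule ell2_UNIV_dominated) auto
instance
proof
  fix u v w :: "'a l2" and r s :: real
  show "u + v + w = u + (v + w)" "u + v = v + u" "0 + u = u" "- u + u = 0"
    "r *\<^sub>R (u + v) = r *\<^sub>R u + r *\<^sub>R v" "(r + s) *\<^sub>R u = r *\<^sub>R u + s *\<^sub>R u"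
    "r *\<^sub>R s *\<^sub>R u = (r * s) *\<^sub>R u" "1 *\<^sub>R u = u"
    by (transfer; simp add: algebra_simps)+
  show "u - v = u + - v" by (simp only: minus_l2_def)
qed

end

lemma coord_simps [simp]:
  "coord 0 i = 0" "coord (u + v) i = coord u i + coord v i" "coord (- u) i = - coord u i"
  "coord (u - v) i = coord u i - coord v i" "coord (r *\<^sub>R u) i = r *\<^sub>R coord u i"
  by (simp_all only: zero_l2.rep_eq plus_l2.rep_eq uminus_l2.rep_eq scaleR_l2.rep_eq minus_l2_def
      diff_conv_add_uminus)

instantiation l2 :: (type) real_inner
begin

text \<open>With the real inner product on the complex numbers this is the real part of the
  Hermitian product, so it induces the usual norm.\<close>

definition inner_l2 :: "'a l2 \<Rightarrow> 'a l2 \<Rightarrow> real" where "inner_l2 u v = (\<Sum>\<^sub>\<infinity>i. coord u i \<bullet> coord v i)"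
definition norm_l2 :: "'a l2 \<Rightarrow> real" where "norm_l2 u = sqrt (u \<bullet> u)"
definition dist_l2 :: "'a l2 \<Rightarrow> 'a l2 \<Rightarrow> real" where "dist_l2 u v = norm (u - v)"
definition sgn_l2 :: "'a l2 \<Rightarrow> 'a l2" where "sgn_l2 u = u /\<^sub>R norm u"
definition uniformity_l2 :: "('a l2 \<times> 'a l2) filter" where
  "uniformity_l2 = (INF e\<in>{0<..}. principal {(x, y). dist x y < e})"
definition open_l2 :: "'a l2 set \<Rightarrow> bool" where
  "open_l2 U = (\<forall>x\<in>U. \<forall>\<^sub>F (x', y) in uniformity. x' = x \<longrightarrow> y \<in> U)"

instance
proof
  fix u v w :: "'a l2" and r s :: real
  note summ = ell2_UNIV_inner_summable[OF coord coord]
  show "dist u v = norm (u - v)" by (simp only: dist_l2_def)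
  show "sgn u = u /\<^sub>R norm u" by (simp only: sgn_l2_def)
  show "norm u = sqrt (u \<bullet> u)" by (simp only: norm_l2_def)
  show "uniformity = (INF e\<in>{0<..}. principal {(x :: 'a l2, y). dist x y < e})"
    by (simp only: uniformity_l2_def)
  show "open U = (\<forall>x\<in>U. \<forall>\<^sub>F (x', y) in uniformity. x' = x \<longrightarrow> y \<in> U)" for U :: "'a l2 set"
    by (simp only: open_l2_def)
  show "u \<bullet> v = v \<bullet> u" by (simp add: inner_l2_def inner_commute)
  show "(u + v) \<bullet> w = u \<bullet> w + v \<bullet> w"
    unfolding inner_l2_def infsum_add[OF summ summ, symmetric] by (simp add: inner_add_left)
  show "r *\<^sub>R u \<bullet> v = r * (u \<bullet> v)"
    unfolding inner_l2_def infsum_cmult_right[OF summ, symmetric] by (simp)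
  show "0 \<le> u \<bullet> u" unfolding inner_l2_def by (intro infsum_nonneg) simp
  show "u \<bullet> u = 0 \<longleftrightarrow> u = 0"
  proof
    assume "u \<bullet> u = 0"
    then have "coord u i \<bullet> coord u i = 0" for i
      unfolding inner_l2_def using nonneg_infsum_le_0D[of "\<lambda>i. coord u i \<bullet> coord u i" UNIV i, OF _ summ] by simp
    then show "u = 0" by (intro l2_eqI) simp
  qed (simp add: inner_l2_def)
qed

end

lemma coord_Abs_l2: "u \<in> ell2 UNIV \<Longrightarrow> coord (Abs_l2 u) = u"
  by (rule Abs_l2_inverse)

lemma l2_norm_sq: "(norm u)\<^sup>2 = (\<Sum>\<^sub>\<infinity>i. (cmod (coord u i))\<^sup>2)"
  by (simp add: power2_norm_eq_inner inner_l2_def)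

lemma l2_sq_summable: "(\<lambda>i. (cmod (coord u i))\<^sup>2) summable_on A"
  using coord[of u] unfolding ell2_UNIV_iff by (rule summable_on_subset) simp

lemma l2_finite_sum_le: "finite F \<Longrightarrow> (\<Sum>i\<in>F. (cmod (coord u i))\<^sup>2) \<le> (norm u)\<^sup>2"
  unfolding l2_norm_sq by (rule finite_sum_le_infsum[OF l2_sq_summable]) auto

lemma l2_coord_le: "cmod (coord u i) \<le> norm u"
  by (rule power2_le_imp_le) (use l2_finite_sum_le[of "{i}" u] in simp_all)

text \<open>Bounds on finite partial sums survive coordinatewise limits, so this criterion yields
  membership and the norm bound in the completeness proof.\<close>

lemma ell2_of_finite_sums:
  assumes "B \<ge> 0" "\<And>F. finite F \<Longrightarrow> (\<Sum>i\<in>F. (cmod (u i))\<^sup>2) \<le> B\<^sup>2"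
  shows "u \<in> ell2 UNIV" "norm (Abs_l2 u) \<le> B"
proof -
  show *: "u \<in> ell2 UNIV"
    unfolding ell2_UNIV_iff
  proof (rule nonneg_bdd_above_summable_on)
    show "bdd_above (sum (\<lambda>i. (cmod (u i))\<^sup>2) ` {F. F \<subseteq> UNIV \<and> finite F})"
      by (rule bdd_aboveI2[where M = "B\<^sup>2"]) (blast intro: assms(2))
  qed simp
  have "(\<Sum>\<^sub>\<infinity>i. (cmod (u i))\<^sup>2) \<le> B\<^sup>2"
    by (rule infsum_le_finite_sums[OF *[unfolded ell2_UNIV_iff] assms(2)])
  then have "(norm (Abs_l2 u))\<^sup>2 \<le> B\<^sup>2"
    unfolding l2_norm_sq coord_Abs_l2[OF *] .
  then show "norm (Abs_l2 u) \<le> B" using assms(1) by (rule power2_le_imp_le)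
qed

lemma l2_norm_dominated:
  assumes "C \<ge> 0" "\<And>i. cmod (coord v i) \<le> C * cmod (coord u i)"
  shows "norm v \<le> C * norm u"
proof -
  have "(\<Sum>i\<in>F. (cmod (coord v i))\<^sup>2) \<le> (C * norm u)\<^sup>2" if "finite F" for F
  proof -
    have "(\<Sum>i\<in>F. (cmod (coord v i))\<^sup>2) \<le> (\<Sum>i\<in>F. C\<^sup>2 * (cmod (coord u i))\<^sup>2)"
      using assms(2) unfolding power_mult_distrib[symmetric] by (intro sum_mono power_mono) auto
    also have "\<dots> \<le> C\<^sup>2 * (norm u)\<^sup>2"
      unfolding sum_distrib_left[symmetric] by (intro mult_left_mono l2_finite_sum_le that) auto
    finally show ?thesis by (simp add: power_mult_distrib)
  qed
  then show ?thesis using ell2_of_finite_sums(2)[of "C * norm u" "coord v"] assms(1) by (simp add: coord_inverse)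
qed

lemma bounded_linear_coord: "bounded_linear (\<lambda>u. coord u i)"
  by (rule bounded_linear_intro[where K = 1]) (auto simp: l2_coord_le)

instance l2 :: (type) complete_space
proof
  fix X :: "nat \<Rightarrow> 'a l2"
  assume X: "Cauchy X"
  have "Cauchy (\<lambda>n. coord (X n) i)" for i
    using bounded_linear.Cauchy[OF bounded_linear_coord X] .
  then have "\<exists>l. (\<lambda>n. coord (X n) i) \<longlonglongrightarrow> l" for i
    using Cauchy_convergent convergent_def by blast
  then obtain x where x: "\<And>i. (\<lambda>n. coord (X n) i) \<longlonglongrightarrow> x i" by metis
  \<comment> \<open>The index \<open>N\<close> does not depend on \<open>F\<close>, so letting
    \<open>m\<close> tend to infinity in a finite sum gives an estimate uniform in
    \<open>F\<close>.\<close>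
  have bound: "(\<Sum>i\<in>F. (cmod (coord (X n) i - x i))\<^sup>2) \<le> e\<^sup>2"
    if N: "\<forall>m\<ge>N. \<forall>n\<ge>N. norm (X m - X n) < e" and n: "n \<ge> N" and F: "finite F" for N n e F
  proof (rule LIMSEQ_le_const2)
    show "(\<lambda>m. \<Sum>i\<in>F. (cmod (coord (X n) i - coord (X m) i))\<^sup>2) \<longlonglongrightarrow> (\<Sum>i\<in>F. (cmod (coord (X n) i - x i))\<^sup>2)"
      by (intro tendsto_intros x)
    have "(\<Sum>i\<in>F. (cmod (coord (X n) i - coord (X m) i))\<^sup>2) \<le> e\<^sup>2" if "m \<ge> N" for m
    proof -
      have "(norm (X n - X m))\<^sup>2 \<le> e\<^sup>2" using N n that by (intro power_mono[OF less_imp_le norm_ge_zero]) auto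
      then show ?thesis using l2_finite_sum_le[OF F, of "X n - X m"] by simp
    qed
    then show "\<exists>N. \<forall>m\<ge>N. (\<Sum>i\<in>F. (cmod (coord (X n) i - coord (X m) i))\<^sup>2) \<le> e\<^sup>2" by blast
  qed
  obtain N where "\<forall>m\<ge>N. \<forall>n\<ge>N. norm (X m - X n) < 1"
    using CauchyD[OF X, of 1] by auto
  then have "(\<lambda>i. coord (X N) i - x i) \<in> ell2 UNIV"
    using bound[of N 1 N] by (intro ell2_of_finite_sums(1)[of 1]) auto
  from ell2_UNIV_dominated[OF this, of "\<lambda>i. x i - coord (X N) i" 1]
  have "(\<lambda>i. x i - coord (X N) i) \<in> ell2 UNIV" by (simp add: norm_minus_commute)
  from ell2_UNIV_add[OF coord[of "X N"] this] have xin: "x \<in> ell2 UNIV" by simp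
  have "X \<longlonglongrightarrow> Abs_l2 x"
  proof (rule LIMSEQ_I)
    fix r :: real assume r: "r > 0"
    then obtain N where N: "\<forall>m\<ge>N. \<forall>n\<ge>N. norm (X m - X n) < r / 2"
      using CauchyD[OF X, of "r / 2"] by auto
    have "norm (X n - Abs_l2 x) < r" if "n \<ge> N" for n
    proof -
      have "norm (Abs_l2 (coord (X n - Abs_l2 x))) \<le> r / 2"
        using r bound[OF N that] by (intro ell2_of_finite_sums) (auto simp: coord_Abs_l2[OF xin])
      then show ?thesis using r by (simp add: coord_inverse)
    qed
    then show "\<exists>N. \<forall>n\<ge>N. norm (X n - Abs_l2 x) < r" by blast
  qed
  then show "convergent X" by (auto simp: convergent_def)
qed

section \<open>Multiplication operators, embeddings and restrictions\<close>

definition mul_op :: "('i \<Rightarrow> complex) \<Rightarrow> 'i l2 \<Rightarrow> 'i l2" where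
  "mul_op w u = Abs_l2 (\<lambda>i. w i * coord u i)"

text \<open>A bounded multiplier keeps the product square-summable, which is what gives
  \<open>Abs_l2\<close> in \<open>mul_op\<close> its meaning.\<close>

lemma coord_mul_op:
  assumes "\<And>i. cmod (w i) \<le> C"
  shows "coord (mul_op w u) i = w i * coord u i"
proof -
  have "(\<lambda>i. w i * coord u i) \<in> ell2 UNIV"
    by (rule ell2_UNIV_dominated[OF coord, of _ C]) (auto simp: norm_mult intro!: mult_right_mono assms)
  then show ?thesis by (simp add: mul_op_def coord_Abs_l2)
qed

lemma norm_mul_op_le:
  assumes "\<And>i. cmod (w i) \<le> C"
  shows "norm (mul_op w u) \<le> C * norm u"
proof (rule l2_norm_dominated)
  show "C \<ge> 0" using order_trans[OF norm_ge_zero assms] .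
qed (auto simp: coord_mul_op[of w C, OF assms] norm_mult intro!: mult_right_mono assms)

lemma bounded_linear_mul_op:
  assumes "\<And>i. cmod (w i) \<le> C"
  shows "bounded_linear (mul_op w)"
  by (rule bounded_linear_intro[where K = C])
    (auto intro!: l2_eqI simp: coord_mul_op[of w C, OF assms] distrib_left mult.commute[of "norm _"]
      intro: norm_mul_op_le[of w C, OF assms])

lemma inner_mul_op_real:
  assumes "\<And>i. \<bar>w i\<bar> \<le> C"
  shows "mul_op (\<lambda>i. of_real (w i)) u \<bullet> v = u \<bullet> mul_op (\<lambda>i. of_real (w i)) v"
  by (simp add: inner_l2_def coord_mul_op[of "\<lambda>i. of_real (w i)" C] assms flip: scaleR_conv_of_real)

text \<open>For injective \<open>g\<close>, \<open>push_op g\<close> is the isometric embedding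
  along \<open>g\<close> with extension by zero, and \<open>pull_op g\<close> is its adjoint. They
  serve as the shift on the integers, as the inclusion of the half-line, and as the relabelling by
  \<open>Suc\<close>.\<close>

definition pull_op :: "('j \<Rightarrow> 'i) \<Rightarrow> 'i l2 \<Rightarrow> 'j l2" where
  "pull_op g u = Abs_l2 (\<lambda>j. coord u (g j))"

definition push_op :: "('j \<Rightarrow> 'i) \<Rightarrow> 'j l2 \<Rightarrow> 'i l2" where
  "push_op g u = Abs_l2 (\<lambda>i. if i \<in> range g then coord u (inv g i) else 0)"

context
  fixes g :: "'j \<Rightarrow> 'i"
  assumes g: "inj g"
begin

lemma coord_pull_op [simp]: "coord (pull_op g u) j = coord u (g j)"
proof -
  have "(\<lambda>j. coord u (g j)) \<in> ell2 UNIV"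
    unfolding ell2_UNIV_iff using summable_on_reindex[OF g, of "\<lambda>i. (cmod (coord u i))\<^sup>2"]
    by (simp add: o_def l2_sq_summable)
  then show ?thesis by (simp add: pull_op_def coord_Abs_l2)
qed

lemma coord_push_op: "coord (push_op g u) i = (if i \<in> range g then coord u (inv g i) else 0)"
proof -
  have "(\<lambda>i. (cmod (coord u (inv g i)))\<^sup>2) summable_on range g"
    using summable_on_reindex[OF g, of "\<lambda>i. (cmod (coord u (inv g i)))\<^sup>2"] g by (simp add: o_def l2_sq_summable)
  then have "(\<lambda>i. (cmod (if i \<in> range g then coord u (inv g i) else 0))\<^sup>2) summable_on UNIV"
    by (rule summable_on_cong_neutral[THEN iffD1, rotated -1]) auto
  then show ?thesis by (simp add: push_op_def coord_Abs_l2 ell2_UNIV_iff)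
qed

lemma coord_push_op_range [simp]: "coord (push_op g u) (g j) = coord u j"
  using g by (simp add: coord_push_op)

lemma pull_push_op [simp]: "pull_op g (push_op g u) = u"
  by (rule l2_eqI) simp

lemma inner_push_op: "push_op g u \<bullet> v = u \<bullet> pull_op g v"
proof -
  have "(\<Sum>\<^sub>\<infinity>i. coord (push_op g u) i \<bullet> coord v i) = (\<Sum>\<^sub>\<infinity>i\<in>range g. coord (push_op g u) i \<bullet> coord v i)"
    by (rule infsum_cong_neutral) (auto simp: coord_push_op)
  also have "\<dots> = (\<Sum>\<^sub>\<infinity>j. coord u j \<bullet> coord v (g j))"
    by (subst infsum_reindex[OF g]) (simp add: o_def)
  finally show ?thesis by (simp add: inner_l2_def)
qed

lemma norm_push_op [simp]: "norm (push_op g u) = norm u"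
  by (simp add: norm_eq_sqrt_inner inner_push_op)

lemma norm_pull_op_le: "norm (pull_op g u) \<le> norm u"
proof -
  have "(norm (pull_op g u))\<^sup>2 = push_op g (pull_op g u) \<bullet> u"
    by (simp add: inner_push_op power2_norm_eq_inner)
  also have "\<dots> \<le> norm (pull_op g u) * norm u" using norm_cauchy_schwarz[of "push_op g (pull_op g u)" u] by simp
  finally show ?thesis by (cases "pull_op g u = 0") (auto simp: power2_eq_square)
qed

lemma bounded_linear_pull_op: "bounded_linear (pull_op g)"
  by (rule bounded_linear_intro[where K = 1]) (auto intro!: l2_eqI simp: norm_pull_op_le)

lemma bounded_linear_push_op: "bounded_linear (push_op g)"
  by (rule bounded_linear_intro[where K = 1]) (auto intro!: l2_eqI simp: coord_push_op)

lemma push_pull_op: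
  assumes "\<And>i. i \<notin> range g \<Longrightarrow> coord u i = 0"
  shows "push_op g (pull_op g u) = u"
  using g assms by (intro l2_eqI) (auto simp: coord_push_op f_inv_into_f)

end

section \<open>Spectra and approximate eigenvectors\<close>

definition cscale :: "complex \<Rightarrow> 'i l2 \<Rightarrow> 'i l2" where
  "cscale z = mul_op (\<lambda>_. z)"

lemma coord_cscale [simp]: "coord (cscale z u) i = z * coord u i"
  unfolding cscale_def by (rule coord_mul_op[of _ "cmod z"]) simp

lemma bounded_linear_cscale: "bounded_linear (cscale z)"
  unfolding cscale_def by (rule bounded_linear_mul_op[of _ "cmod z"]) simp

lemma norm_cscale: "norm (cscale z u) = cmod z * norm u"
proof (rule antisym)
  show *: "norm (cscale z u) \<le> cmod z * norm u" for z :: complex and u :: "'a l2"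
    unfolding cscale_def by (rule norm_mul_op_le) simp
  show "cmod z * norm u \<le> norm (cscale z u)"
  proof (cases "z = 0")
    case False
    have "cscale (inverse z) (cscale z u) = u" using False by (intro l2_eqI) simp
    then have "norm u \<le> cmod (inverse z) * norm (cscale z u)" using *[of "inverse z" "cscale z u"] by simp
    then show ?thesis using False by (simp add: norm_inverse norm_divide field_simps)
  qed simp
qed

text \<open>Multiplication by the imaginary unit is skew for the real inner product; this is what
  removes the cross term in \<open>norm_shifted_sq\<close>.\<close>

lemma inner_cscale_ii: "cscale \<i> u \<bullet> v = - (u \<bullet> cscale \<i> v)"
proof -
  have "cscale \<i> u \<bullet> v = (\<Sum>\<^sub>\<infinity>i. - (coord u i \<bullet> coord (cscale \<i> v) i))"
    unfolding inner_l2_def by (intro infsum_cong) (simp add: inner_complex_def)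
  also have "\<dots> = - (u \<bullet> cscale \<i> v)" unfolding inner_l2_def by (rule infsum_uminus)
  finally show ?thesis .
qed

text \<open>A bounded selfadjoint operator on the complex space: symmetry for the real part of the
  Hermitian product together with complex linearity gives Hermitian symmetry.\<close>

definition complex_linear_symmetric :: "('i l2 \<Rightarrow> 'i l2) \<Rightarrow> bool" where
  "complex_linear_symmetric S \<longleftrightarrow> symmetric_op S \<and> (\<forall>z u. S (cscale z u) = cscale z (S u))"

lemma cscale_of_real: "cscale (of_real r) u = r *\<^sub>R u"
  by (rule l2_eqI) (simp add: scaleR_conv_of_real)

lemma cscale_real:
  assumes "Im z = 0"
  shows "cscale z u = Re z *\<^sub>R u"
  using assms by (intro l2_eqI) (simp add: scaleR_conv_of_real complex_eq_iff)

lemma bounded_linear_shifted: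
  assumes "complex_linear_symmetric S"
  shows "bounded_linear (\<lambda>u. S u - cscale z u)"
  using assms unfolding complex_linear_symmetric_def symmetric_op_def
  by (auto intro: bounded_linear_sub bounded_linear_cscale)

text \<open>For \<open>R = S - Re z\<close>, which is symmetric and commutes with the imaginary
  unit, \<open>R u\<close> is orthogonal to \<open>cscale \<i> u\<close> in the real inner product,
  so Pythagoras applies. In particular nonreal points are never spectral.\<close>

lemma norm_shifted_sq:
  assumes S: "complex_linear_symmetric S"
  shows "(norm (S u - cscale z u))\<^sup>2 = (norm (S u - Re z *\<^sub>R u))\<^sup>2 + (Im z)\<^sup>2 * (norm u)\<^sup>2"
proof -
  let ?R = "\<lambda>u. S u - Re z *\<^sub>R u"
  have symR: "?R x \<bullet> y = x \<bullet> ?R y" for x y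
    using S symmetric_opD(2)[OF symmetric_op_shift] unfolding complex_linear_symmetric_def by blast
  have comm: "?R (cscale \<i> u) = cscale \<i> (?R u)"
    using S unfolding complex_linear_symmetric_def by (intro l2_eqI) (simp add: algebra_simps scaleR_conv_of_real)
  have "?R u \<bullet> cscale \<i> u = - (?R u \<bullet> cscale \<i> u)"
    by (metis comm inner_cscale_ii inner_commute symR)
  then have orth: "?R u \<bullet> cscale \<i> u = 0" by simp
  have "S u - cscale z u = ?R u - Im z *\<^sub>R cscale \<i> u"
    by (rule l2_eqI) (simp add: scaleR_conv_of_real complex_eq_iff)
  then have "(norm (S u - cscale z u))\<^sup>2 = (norm (?R u - Im z *\<^sub>R cscale \<i> u))\<^sup>2" by (simp only:)
  also have "\<dots> = (norm (?R u))\<^sup>2 - 2 * Im z * (?R u \<bullet> cscale \<i> u) + (Im z)\<^sup>2 * (norm (cscale \<i> u))\<^sup>2"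
    by (simp add: power2_norm_eq_inner inner_diff_left inner_diff_right inner_commute power2_eq_square[of "Im z"])
      (simp add: algebra_simps)
  finally show ?thesis unfolding orth by (simp add: norm_cscale)
qed

text \<open>With \<open>R = S - Re z\<close>, the operator \<open>R^2 + (Im z)^2\<close> is the
  product of \<open>S - z\<close> and its adjoint, and the lower bound on \<open>S - z\<close> makes
  it coercive. A solution \<open>w\<close> for the product gives one for \<open>S - z\<close> by
  applying the adjoint to \<open>w\<close>.\<close>

lemma shifted_surjective:
  assumes S: "complex_linear_symmetric S" and bb: "bounded_below (\<lambda>u. S u - cscale z u)"
  shows "\<exists>u. S u - cscale z u = v"
proof -
  define R where "R u = S u - Re z *\<^sub>R u" for u
  have symR: "symmetric_op R"
    using S symmetric_op_shift unfolding complex_linear_symmetric_def R_def[abs_def] by blast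
  note blR = symmetric_opD(1)[OF symR]
  interpret bounded_linear R by (rule blR)
  obtain c where c: "c > 0" "\<And>x. c * norm x \<le> norm (S x - cscale z x)"
    using bb unfolding bounded_below_def by blast
  let ?A = "\<lambda>u. R (R u) + (Im z)\<^sup>2 *\<^sub>R u"
  have "\<exists>w\<in>UNIV. ?A w = v"
  proof (rule coercive_surjective)
    show "bounded_linear ?A"
      by (intro bounded_linear_add bounded_linear_compose[OF blR blR] bounded_linear_scaleR_right)
    show "c\<^sup>2 > 0" using c(1) by simp
    fix x
    have "(c * norm x)\<^sup>2 \<le> (norm (S x - cscale z x))\<^sup>2" using c by (intro power_mono) auto
    also have "\<dots> = ?A x \<bullet> x"
      unfolding norm_shifted_sq[OF S] using symmetric_opD(2)[OF symR, of "R x" x]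
      by (simp add: R_def[symmetric] inner_add_left power2_norm_eq_inner)
    finally show "c\<^sup>2 * (norm x)\<^sup>2 \<le> ?A x \<bullet> x" by (simp add: power_mult_distrib)
  qed auto
  then obtain w where w: "?A w = v" by blast
  have comm: "S (cscale (\<i> * Im z) w) = cscale (\<i> * Im z) (S w)"
    using S unfolding complex_linear_symmetric_def by blast
  \<comment> \<open>This is \<open>S\<close> minus the conjugate of \<open>z\<close>, applied to
    \<open>w\<close>.\<close>
  define u where "u = R w + cscale (\<i> * Im z) w"
  have "S u = S (R w) + S (cscale (\<i> * Im z) w)"
    unfolding u_def using S unfolding complex_linear_symmetric_def symmetric_op_def
    by (simp add: linear_simps)
  then have "S u - cscale z u = ?A w"
    unfolding comm by (intro l2_eqI)
      (simp add: u_def R_def scaleR_conv_of_real complex_eq_iff algebra_simps power2_eq_square)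
  then show ?thesis using w by blast
qed

lemma coord_push_in_ell2:
  assumes "inj g"
  shows "coord (push_op g v) \<in> ell2 (range g)" "ell2_norm (range g) (coord (push_op g v)) = norm v"
proof -
  show "coord (push_op g v) \<in> ell2 (range g)"
    using l2_sq_summable[of "push_op g v" "range g"] by (simp add: ell2_def) (simp add: coord_push_op[OF assms])
  have "(\<Sum>\<^sub>\<infinity>i\<in>range g. (cmod (coord (push_op g v) i))\<^sup>2) = (norm (push_op g v))\<^sup>2"
    unfolding l2_norm_sq by (rule infsum_cong_neutral) (auto simp: coord_push_op[OF assms])
  then show "ell2_norm (range g) (coord (push_op g v)) = norm v"
    by (simp add: ell2_norm_def norm_push_op[OF assms])
qed

lemma ell2_as_coord_push:
  assumes g: "inj g" and u: "u \<in> ell2 (range g)"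
  obtains v where "u = coord (push_op g v)"
proof -
  have "(\<lambda>j. u (g j)) \<in> ell2 UNIV"
    using u summable_on_reindex[OF g, of "\<lambda>i. (cmod (u i))\<^sup>2"] by (simp add: ell2_def o_def)
  then have "u = coord (push_op g (Abs_l2 (\<lambda>j. u (g j))))"
    using u g by (intro ext) (auto simp: coord_push_op[OF g] coord_Abs_l2 ell2_def)
  then show ?thesis by (rule that)
qed

text \<open>Carries the spectrum of an operator on functions over the index set
  \<open>range g\<close> to the operator \<open>S\<close> on the type \<open>l2\<close>. A lower
  bound gives injectivity and the norm bound of the inverse; surjectivity is
  \<open>shifted_surjective\<close>.\<close>

lemma spectrum_iff_not_bounded_below:
  assumes g: "inj g" and S: "complex_linear_symmetric S"
    and T: "\<And>v. T (coord (push_op g v)) = coord (push_op g (S v))"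
  shows "z \<in> spectrum (range g) T \<longleftrightarrow> \<not> bounded_below (\<lambda>v. S v - cscale z v)"
proof -
  let ?I = "range g" and ?D = "\<lambda>v. S v - cscale z v"
  have sh: "shifted T z (coord (push_op g v)) = coord (push_op g (?D v))" for v
    by (rule ext) (simp add: shifted_def T coord_push_op[OF g])
  have inj_push: "coord (push_op g v) = coord (push_op g w) \<longleftrightarrow> v = w" for v w
    by (metis coord_inject pull_push_op[OF g])
  interpret D: bounded_linear ?D by (rule bounded_linear_shifted[OF S])
  have "z \<in> resolvent_set ?I T \<longleftrightarrow> bounded_below ?D"
  proof
    assume "z \<in> resolvent_set ?I T"
    then obtain C where C: "\<forall>u\<in>ell2 ?I. ell2_norm ?I u \<le> C * ell2_norm ?I (shifted T z u)"
      unfolding resolvent_set_def by blast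
    \<comment> \<open>The constant in \<open>resolvent_set\<close> may have any sign; the maximum
      makes its reciprocal a legitimate lower bound.\<close>
    have "norm v \<le> max C 1 * norm (?D v)" for v
    proof -
      have "norm v \<le> C * norm (?D v)"
        using bspec[OF C coord_push_in_ell2(1)[OF g, of v]] unfolding sh by (simp only: coord_push_in_ell2(2)[OF g])
      also have "\<dots> \<le> max C 1 * norm (?D v)" by (intro mult_right_mono) auto
      finally show ?thesis .
    qed
    then have "\<forall>v. (1 / max C 1) * norm v \<le> norm (?D v)" by (simp add: field_simps)
    then show "bounded_below ?D" unfolding bounded_below_def by (intro exI[of _ "1 / max C 1"]) auto
  next
    assume bb: "bounded_below ?D"
    then obtain c where c: "c > 0" "\<And>x. c * norm x \<le> norm (?D x)" unfolding bounded_below_def by blast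
    have injD: "v = w" if "?D v = ?D w" for v w
    proof -
      have "?D (v - w) = 0" using that by (simp add: D.diff)
      then have "c * norm (v - w) \<le> 0" using c(2)[of "v - w"] by simp
      then show ?thesis using c(1) by (simp add: mult_le_0_iff)
    qed
    have "bij_betw (shifted T z) (ell2 ?I) (ell2 ?I)"
      unfolding bij_betw_def
    proof
      show "inj_on (shifted T z) (ell2 ?I)"
      proof (rule inj_onI)
        fix x y assume *: "x \<in> ell2 ?I" "y \<in> ell2 ?I" "shifted T z x = shifted T z y"
        obtain v w where vw: "x = coord (push_op g v)" "y = coord (push_op g w)"
          using ell2_as_coord_push[OF g] *(1,2) by metis
        have "?D v = ?D w" using *(3) unfolding vw sh inj_push .
        then show "x = y" using injD vw by blast
      qed
      have "x \<in> shifted T z ` ell2 ?I" if x: "x \<in> ell2 ?I" for x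
      proof -
        obtain v where v: "x = coord (push_op g v)" using ell2_as_coord_push[OF g x] .
        obtain u where "?D u = v" using shifted_surjective[OF S bb] by blast
        then have "x = shifted T z (coord (push_op g u))" by (simp only: v sh)
        then show ?thesis using coord_push_in_ell2(1)[OF g] by blast
      qed
      moreover have "shifted T z x \<in> ell2 ?I" if x: "x \<in> ell2 ?I" for x
        using ell2_as_coord_push[OF g x] coord_push_in_ell2(1)[OF g] by (metis sh)
      ultimately show "shifted T z ` ell2 ?I = ell2 ?I" by blast
    qed
    moreover have "\<forall>u\<in>ell2 ?I. ell2_norm ?I u \<le> (1 / c) * ell2_norm ?I (shifted T z u)"
    proof
      fix x assume x: "x \<in> ell2 ?I"
      obtain v where v: "x = coord (push_op g v)" using ell2_as_coord_push[OF g x] .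
      show "ell2_norm ?I x \<le> (1 / c) * ell2_norm ?I (shifted T z x)"
        unfolding v sh coord_push_in_ell2(2)[OF g] using c by (simp add: field_simps)
    qed
    ultimately show "z \<in> resolvent_set ?I T" unfolding resolvent_set_def by blast
  qed
  then show ?thesis by (simp add: spectrum_def)
qed

lemma spectrum_point_real:
  assumes "complex_linear_symmetric S" "\<not> bounded_below (\<lambda>v. S v - cscale z v)"
  shows "Im z = 0"
proof (rule ccontr)
  assume "Im z \<noteq> 0"
  have "\<bar>Im z\<bar> * norm v \<le> norm (S v - cscale z v)" for v
    by (rule power2_le_imp_le) (auto simp: norm_shifted_sq[OF assms(1)] power_mult_distrib)
  then have "bounded_below (\<lambda>v. S v - cscale z v)"
    unfolding bounded_below_def using \<open>Im z \<noteq> 0\<close> by (intro exI[of _ "\<bar>Im z\<bar>"]) auto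
  then show False using assms(2) by simp
qed

section \<open>Finite truncations and approximate eigenvectors\<close>

lemma l2_norm_sq_finite:
  assumes "finite F" "\<And>i. i \<notin> F \<Longrightarrow> coord x i = 0"
  shows "(norm x)\<^sup>2 = (\<Sum>i\<in>F. (cmod (coord x i))\<^sup>2)"
proof -
  have "(\<Sum>\<^sub>\<infinity>i. (cmod (coord x i))\<^sup>2) = (\<Sum>\<^sub>\<infinity>i\<in>F. (cmod (coord x i))\<^sup>2)"
    by (rule infsum_cong_neutral) (use assms(2) in auto)
  then show ?thesis using assms(1) by (simp add: l2_norm_sq)
qed

lemma coord_mul_indicator [simp]: "coord (mul_op (indicator F) x) i = indicator F i * coord x i"
  by (rule coord_mul_op[of _ 1]) (simp add: indicator_def)

lemma bounded_linear_mul_indicator: "bounded_linear (mul_op (indicator F))"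
  by (rule bounded_linear_mul_op[of _ 1]) (simp add: indicator_def)

lemma finite_truncation:
  assumes "e > 0"
  obtains F where "finite F" "norm (x - mul_op (indicator F) x) < e"
proof -
  \<comment> \<open>The finite approximation of the sum comes with a non-strict error bound; half of
    \<open>e^2\<close> keeps the conclusion strict.\<close>
  define e2 where "e2 = e\<^sup>2 / 2"
  have e2: "e2 > 0" "e2 < e\<^sup>2" using assms by (auto simp: e2_def)
  obtain F where F: "finite F" "dist (\<Sum>i\<in>F. (cmod (coord x i))\<^sup>2) ((norm x)\<^sup>2) \<le> e2"
    using infsum_finite_approximation[OF l2_sq_summable[of x UNIV] e2(1)] unfolding l2_norm_sq by blast
  let ?y = "mul_op (indicator F) x"
  have "?y \<bullet> (x - ?y) = 0"
    unfolding inner_l2_def by (rule infsum_0) (simp add: indicator_def)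
  then have "(norm (?y + (x - ?y)))\<^sup>2 = (norm ?y)\<^sup>2 + (norm (x - ?y))\<^sup>2" by (rule norm_add_Pythagorean[unfolded orthogonal_def])
  moreover have "(norm ?y)\<^sup>2 = (\<Sum>i\<in>F. (cmod (coord x i))\<^sup>2)"
    using F(1) by (subst l2_norm_sq_finite[of F]) auto
  ultimately have "(norm (x - ?y))\<^sup>2 < e\<^sup>2" using F(2) e2(2) by (simp add: dist_real_def)
  then have "norm (x - ?y) < e" by (rule power2_less_imp_less) (use assms in simp)
  then show ?thesis using that F(1) by blast
qed

text \<open>The strict inequality is stable under small perturbations of \<open>x\<close>. Replacing
  \<open>x\<close> by its truncation costs at most \<open>K + \<bar>e\<bar>\<close> times the
  distance, and \<open>g\<close> is the available slack divided by this factor.\<close>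

lemma finite_truncation_approximate_kernel:
  assumes D: "bounded_linear D" and x: "norm (D x) < e * norm x"
  obtains F where "finite F" "norm (D (mul_op (indicator F) x)) < e * norm (mul_op (indicator F) x)"
proof -
  interpret bounded_linear D by fact
  obtain K where K: "K > 0" "\<And>x. norm (D x) \<le> norm x * K" using pos_bounded by blast
  define g where "g = (e * norm x - norm (D x)) / (K + \<bar>e\<bar>)"
  have g: "g > 0" using x K by (simp add: g_def add_pos_nonneg)
  obtain F where F: "finite F" "norm (x - mul_op (indicator F) x) < g" using finite_truncation[OF g] .
  let ?y = "mul_op (indicator F) x"
  have "norm (D ?y) \<le> norm (D x) + norm (D (x - ?y))"
    using norm_triangle_ineq4[of "D x" "D (x - ?y)"] by (simp add: diff)
  also have "norm (D (x - ?y)) \<le> K * norm (x - ?y)" using K(2)[of "x - ?y"] by (simp add: mult.commute)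
  finally have 1: "norm (D ?y) \<le> norm (D x) + K * norm (x - ?y)" by simp
  have "e * norm x - e * norm ?y = e * (norm x - norm ?y)" by (simp add: right_diff_distrib)
  also have "\<dots> \<le> \<bar>e\<bar> * \<bar>norm x - norm ?y\<bar>" by (metis abs_ge_self abs_mult)
  also have "\<dots> \<le> \<bar>e\<bar> * norm (x - ?y)" by (intro mult_left_mono norm_triangle_ineq3) auto
  finally have 2: "e * norm x - e * norm ?y \<le> \<bar>e\<bar> * norm (x - ?y)" .
  have "(K + \<bar>e\<bar>) * norm (x - ?y) < (K + \<bar>e\<bar>) * g" using F(2) K(1) by (intro mult_strict_left_mono) auto
  also have "\<dots> = e * norm x - norm (D x)" using K(1) by (simp add: g_def)
  finally have "norm (D ?y) < e * norm ?y" using 1 2 by (simp add: distrib_right)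
  then show ?thesis using that F(1) by blast
qed

text \<open>The bound \<open>e\<close> is for the square of the residual norm. The residual is
  summed over one more site on each side because a tridiagonal matrix enlarges supports by one. With
  only finite sums, the notion passes to coordinatewise limits on a fixed window.\<close>

definition approx_eigenvector ::
    "(int \<Rightarrow> real) \<Rightarrow> (int \<Rightarrow> real) \<Rightarrow> complex \<Rightarrow> real \<Rightarrow> int \<Rightarrow> int \<Rightarrow> (int \<Rightarrow> complex) \<Rightarrow> bool" where
  "approx_eigenvector a b z e p q u \<longleftrightarrow> (\<forall>n. n \<notin> {p..q} \<longrightarrow> u n = 0) \<and> (\<Sum>n\<in>{p..q}. (cmod (u n))\<^sup>2) = 1
     \<and> (\<Sum>n\<in>{p - 1..q + 1}. (cmod (shifted (jacobi_two_sided a b) z u n))\<^sup>2) \<le> e"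

lemma shifted_jacobi_support:
  assumes "\<And>n. n \<notin> {p..q} \<Longrightarrow> u n = 0" "n \<notin> {p - 1..q + 1}"
  shows "shifted (jacobi_two_sided a b) z u n = 0"
proof -
  have "n \<notin> {p..q}" "n - 1 \<notin> {p..q}" "n + 1 \<notin> {p..q}" using assms(2) by auto
  then show ?thesis using assms(1) by (simp add: shifted_def jacobi_two_sided_def)
qed

text \<open>Written as superdiagonal, diagonal and subdiagonal parts, where the first and the last
  are adjoint to each other by \<open>inner_push_op\<close>; this makes symmetry evident.\<close>

definition jacobi_op :: "(int \<Rightarrow> real) \<Rightarrow> (int \<Rightarrow> real) \<Rightarrow> int l2 \<Rightarrow> int l2" where
  "jacobi_op a b u = mul_op (\<lambda>n. of_real (a n)) (pull_op (\<lambda>n. n + 1) u) + mul_op (\<lambda>n. of_real (b n)) u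
     + push_op (\<lambda>n. n + 1) (mul_op (\<lambda>n. of_real (a n)) u)"

text \<open>Instantiated both for the right limits and for the two-sided extension of the one-sided
  parameters.\<close>

locale bounded_jacobi =
  fixes a b :: "int \<Rightarrow> real" and K :: real
  assumes bnd: "\<And>n. \<bar>a n\<bar> \<le> K" "\<And>n. \<bar>b n\<bar> \<le> K"
begin

lemma coord_jacobi_op: "coord (jacobi_op a b u) = jacobi_two_sided a b (coord u)"
proof
  fix n :: int
  have i: "inj (\<lambda>n :: int. n + 1)" by (simp add: inj_def)
  have "coord (push_op (\<lambda>n. n + 1) w) n = coord w (n - 1)" for w
    using coord_push_op_range[OF i, of w "n - 1"] by simp
  then show "coord (jacobi_op a b u) n = jacobi_two_sided a b (coord u) n"
    using bnd by (simp add: jacobi_op_def jacobi_two_sided_def coord_pull_op[OF i] coord_mul_op[of _ K])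
qed

lemma complex_linear_symmetric_jacobi_op: "complex_linear_symmetric (jacobi_op a b)"
proof -
  have i: "inj (\<lambda>n :: int. n + 1)" by (simp add: inj_def)
  have *: "bounded_linear (mul_op (\<lambda>n. of_real (a n)))" "bounded_linear (mul_op (\<lambda>n. of_real (b n)))"
    using bnd by (auto intro!: bounded_linear_mul_op[of _ K])
  have "bounded_linear (jacobi_op a b)"
    unfolding jacobi_op_def[abs_def]
    by (intro bounded_linear_add * bounded_linear_compose[OF *(1) bounded_linear_pull_op[OF i]]
        bounded_linear_compose[OF bounded_linear_push_op[OF i] *(1)])
  moreover have "jacobi_op a b u \<bullet> v = u \<bullet> jacobi_op a b v" for u v
    using inner_mul_op_real[of a K, OF bnd(1)] inner_mul_op_real[of b K, OF bnd(2)]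
      inner_push_op[OF i] inner_push_op[OF i, of v, symmetric]
    by (simp add: jacobi_op_def inner_add_left inner_add_right) (metis inner_commute inner_push_op[OF i])
  moreover have "jacobi_op a b (cscale z u) = cscale z (jacobi_op a b u)" for z u
    by (rule l2_eqI) (simp add: coord_jacobi_op jacobi_two_sided_def algebra_simps)
  ultimately show ?thesis unfolding complex_linear_symmetric_def symmetric_op_def by blast
qed

lemma spectrum_two_sided_iff:
  "z \<in> spectrum UNIV (jacobi_two_sided a b) \<longleftrightarrow> \<not> bounded_below (\<lambda>u. jacobi_op a b u - cscale z u)"
proof -
  have i: "inj (\<lambda>n :: int. n)" by (simp add: inj_def)
  have "push_op (\<lambda>n. n) v = v" for v :: "int l2"
    using coord_push_op_range[OF i, of v] by (intro l2_eqI) simp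
  then show ?thesis
    using spectrum_iff_not_bounded_below[OF i complex_linear_symmetric_jacobi_op, of "jacobi_two_sided a b" z]
    by (simp add: coord_jacobi_op)
qed

lemma norm_jacobi_op_finite_support:
  assumes "\<And>n. n \<notin> {p..q} \<Longrightarrow> coord x n = 0"
  shows "(norm (jacobi_op a b x - cscale z x))\<^sup>2
    = (\<Sum>n\<in>{p - 1..q + 1}. (cmod (shifted (jacobi_two_sided a b) z (coord x) n))\<^sup>2)"
proof -
  have c: "coord (jacobi_op a b x - cscale z x) n = shifted (jacobi_two_sided a b) z (coord x) n" for n
    by (simp add: coord_jacobi_op shifted_def)
  show ?thesis
    unfolding c[symmetric] by (rule l2_norm_sq_finite) (auto simp only: c intro!: shifted_jacobi_support[OF assms])
qed

lemma approx_eigenvector_of_l2: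
  assumes supp: "\<And>n. n \<notin> {p..q} \<Longrightarrow> coord x n = 0" and x: "x \<noteq> 0"
    and d: "norm (jacobi_op a b x - cscale z x) \<le> d * norm x"
  shows "\<exists>u. approx_eigenvector a b z (d\<^sup>2) p q u"
proof -
  interpret bounded_linear "\<lambda>x. jacobi_op a b x - cscale z x"
    by (rule bounded_linear_shifted[OF complex_linear_symmetric_jacobi_op])
  let ?y = "(1 / norm x) *\<^sub>R x"
  have y: "norm ?y = 1" using x by simp
  have supp': "coord ?y n = 0" if "n \<notin> {p..q}" for n using supp[OF that] by simp
  have "norm (jacobi_op a b ?y - cscale z ?y) = norm (jacobi_op a b x - cscale z x) / norm x"
    unfolding scaleR by (simp only: norm_scaleR) simp
  also have "\<dots> \<le> d" using x d by (simp add: field_simps)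
  finally have "norm (jacobi_op a b ?y - cscale z ?y) \<le> d" .
  then have "(norm (jacobi_op a b ?y - cscale z ?y))\<^sup>2 \<le> d\<^sup>2" by (intro power_mono) auto
  then have "(\<Sum>n\<in>{p - 1..q + 1}. (cmod (shifted (jacobi_two_sided a b) z (coord ?y) n))\<^sup>2) \<le> d\<^sup>2"
    by (subst (asm) norm_jacobi_op_finite_support[OF supp']) auto
  moreover have "(\<Sum>n\<in>{p..q}. (cmod (coord ?y n))\<^sup>2) = 1"
    using l2_norm_sq_finite[of "{p..q}", OF _ supp'] y by simp
  ultimately have "approx_eigenvector a b z (d\<^sup>2) p q (coord ?y)"
    unfolding approx_eigenvector_def using supp' by blast
  then show ?thesis by blast
qed

lemma l2_of_approx_eigenvector:
  assumes "approx_eigenvector a b z e p q u"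
  obtains x where "coord x = u" "norm x = 1" "norm (jacobi_op a b x - cscale z x) \<le> sqrt e"
proof -
  have supp: "u n = 0" if "n \<notin> {p..q}" for n using assms that unfolding approx_eigenvector_def by blast
  have "u \<in> ell2 UNIV"
    unfolding ell2_UNIV_iff
    by (rule summable_on_cong_neutral[THEN iffD1, of _ "{p..q}" "\<lambda>n. (cmod (u n))\<^sup>2"]) (use supp in auto)
  then have c: "coord (Abs_l2 u) = u" by (rule coord_Abs_l2)
  have supp': "coord (Abs_l2 u) n = 0" if "n \<notin> {p..q}" for n using supp[OF that] c by simp
  have "(norm (Abs_l2 u))\<^sup>2 = 1"
    using assms l2_norm_sq_finite[of "{p..q}", OF _ supp'] unfolding approx_eigenvector_def c by auto
  then have "norm (Abs_l2 u) = 1" by (simp add: power2_eq_1_iff) (smt (verit) norm_ge_zero)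
  moreover have "norm (jacobi_op a b (Abs_l2 u) - cscale z (Abs_l2 u)) \<le> sqrt e"
    using norm_jacobi_op_finite_support[OF supp'] assms unfolding approx_eigenvector_def c
    by (intro real_le_rsqrt) simp
  ultimately show ?thesis using that c by blast
qed

lemma spectrum_two_sided_approx_eigenvector:
  assumes "z \<in> spectrum UNIV (jacobi_two_sided a b)" "e > 0"
  shows "\<exists>p q u. approx_eigenvector a b z e p q u"
proof -
  let ?D = "\<lambda>x. jacobi_op a b x - cscale z x"
  have D: "bounded_linear ?D"
    by (rule bounded_linear_shifted[OF complex_linear_symmetric_jacobi_op])
  have nbb: "\<not> bounded_below ?D" using assms(1) spectrum_two_sided_iff by blast
  obtain x where x: "norm x = 1" "norm (?D x) < sqrt e"
    using not_bounded_below_obtain[OF nbb D, of "sqrt e"] assms(2) by auto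
  then obtain F where F: "finite F" "norm (?D (mul_op (indicator F) x)) < sqrt e * norm (mul_op (indicator F) x)"
    using finite_truncation_approximate_kernel[OF D, of x "sqrt e"] by auto
  let ?y = "mul_op (indicator F) x"
  have y: "?y \<noteq> 0" using F(2) bounded_linear.bounded_linear[OF D] by (auto simp: linear_simps(3)[OF D])
  obtain p q where pq: "F \<subseteq> {p..q}"
    using F(1) by (metis bdd_above_finite bdd_below_finite bdd_above.unfold bdd_below.unfold atLeastAtMost_iff subsetI)
  have "\<exists>u. approx_eigenvector a b z ((sqrt e)\<^sup>2) p q u"
    by (rule approx_eigenvector_of_l2[of p q ?y]) (use F(2) y pq in \<open>auto simp: indicator_def\<close>)
  then show ?thesis using assms(2) by auto
qed

text \<open>A single vector with a fixed error already yields an exact spectral point nearby. This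
  matters because each right limit obtained by compactness comes with a vector for one error
  only.\<close>

lemma spectrum_near_approx_eigenvector:
  assumes "approx_eigenvector a b z e p q u" "Im z = 0"
  shows "\<exists>w\<in>spectrum UNIV (jacobi_two_sided a b). dist w z \<le> sqrt e"
proof -
  obtain x where x: "norm x = 1" "norm (jacobi_op a b x - cscale z x) \<le> sqrt e"
    using l2_of_approx_eigenvector[OF assms(1)] by metis
  have z: "z = of_real (Re z)" using assms(2) by (simp add: complex_eq_iff)
  have sym: "symmetric_op (\<lambda>u. jacobi_op a b u - Re z *\<^sub>R u)"
    using symmetric_op_shift complex_linear_symmetric_jacobi_op unfolding complex_linear_symmetric_def by blast
  have "norm (jacobi_op a b x - Re z *\<^sub>R x) \<le> sqrt e * norm x"
    using x by (metis z cscale_of_real mult.right_neutral)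
  then obtain t where t: "\<bar>t\<bar> \<le> sqrt e" "\<not> bounded_below (\<lambda>u. jacobi_op a b u - Re z *\<^sub>R u - t *\<^sub>R u)"
    using approximate_eigenvalue_near[OF sym, of x "sqrt e"] x(1) by (metis norm_zero zero_neq_one)
  have shift: "jacobi_op a b u - Re z *\<^sub>R u - t *\<^sub>R u = jacobi_op a b u - cscale (of_real (Re z + t)) u" for u
    unfolding cscale_of_real by (simp add: scaleR_add_left)
  have "of_real (Re z + t) \<in> spectrum UNIV (jacobi_two_sided a b)"
    using t(2) unfolding spectrum_two_sided_iff shift .
  moreover have "dist (complex_of_real (Re z + t)) z = \<bar>t\<bar>"
    by (subst z) (simp add: dist_norm flip: of_real_diff)
  ultimately show ?thesis using t(1) by (metis)
qed

end

section \<open>The half-line operator\<close>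

text \<open>Coordinate 0 of a vector in \<open>nat l2\<close> is its value at site 1, hence the
  shift by one; \<open>Suc\<close> plays the same part for the index set
  \<open>{1..}\<close>.\<close>

definition half_line_embedding :: "nat \<Rightarrow> int" where
  "half_line_embedding n = int n + 1"

lemma inj_half_line_embedding: "inj half_line_embedding"
  by (simp add: inj_def half_line_embedding_def)

lemma range_half_line_embedding: "range half_line_embedding = {1..}"
proof -
  have "n \<in> range half_line_embedding" if "n \<ge> 1" for n
    using that by (intro image_eqI[of _ _ "nat (n - 1)"]) (auto simp: half_line_embedding_def)
  then show ?thesis by (auto simp: half_line_embedding_def)
qed

text \<open>The one-sided Jacobi matrix is the compression to the half-line of a two-sided one whose
  entries at nonpositive indices are irrelevant.\<close>

definition half_line_op :: "(nat \<Rightarrow> real) \<Rightarrow> (nat \<Rightarrow> real) \<Rightarrow> nat l2 \<Rightarrow> nat l2" where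
  "half_line_op a b u = pull_op half_line_embedding
     (jacobi_op (\<lambda>n. a (nat n)) (\<lambda>n. b (nat n)) (push_op half_line_embedding u))"

locale bounded_half_line_jacobi =
  fixes a b :: "nat \<Rightarrow> real" and K :: real
  assumes bnd: "\<And>n. \<bar>a n\<bar> \<le> K" "\<And>n. \<bar>b n\<bar> \<le> K"
    and pos: "\<And>n. n \<ge> 1 \<Longrightarrow> a n > 0"
begin

sublocale ext: bounded_jacobi "\<lambda>n. a (nat n)" "\<lambda>n. b (nat n)" K
  by unfold_locales (use bnd in auto)

lemma coord_half_line_op:
  "coord (half_line_op a b u) n = (if n = 0 then 0 else of_real (a n) * coord u (n - 1))
     + of_real (b (n + 1)) * coord u n + of_real (a (n + 1)) * coord u (n + 1)"
proof -
  note i = inj_half_line_embedding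
  have p: "coord (push_op half_line_embedding u) (int m + 1) = coord u m" for m
    using coord_push_op_range[OF i, of u m] by (simp add: half_line_embedding_def)
  have z: "coord (push_op half_line_embedding u) 0 = 0"
    by (simp add: coord_push_op[OF i] range_half_line_embedding)
  have q: "coord (push_op half_line_embedding u) (int n) = (if n = 0 then 0 else coord u (n - 1))"
    using p[of "n - 1"] z by (cases n) (auto simp: add.commute)
  have r: "coord (push_op half_line_embedding u) (int n + 1 + 1) = coord u (n + 1)"
    using p[of "n + 1"] by (simp add: add.commute)
  have "nat (int n + 1) = n + 1" by simp
  then show ?thesis
    using bnd q r p[of n]
    by (simp add: half_line_op_def coord_pull_op[OF i] ext.coord_jacobi_op jacobi_two_sided_def half_line_embedding_def)
qed

lemma complex_linear_symmetric_half_line_op: "complex_linear_symmetric (half_line_op a b)"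
proof -
  note i = inj_half_line_embedding
  let ?J = "jacobi_op (\<lambda>n. a (nat n)) (\<lambda>n. b (nat n))"
  have J: "symmetric_op ?J"
    using ext.complex_linear_symmetric_jacobi_op
    by (simp add: complex_linear_symmetric_def)
  have "bounded_linear (half_line_op a b)"
    unfolding half_line_op_def[abs_def]
    by (intro bounded_linear_compose[OF bounded_linear_pull_op[OF i]]
      bounded_linear_compose[OF symmetric_opD(1)[OF J]] bounded_linear_push_op[OF i])
  moreover have "half_line_op a b u \<bullet> v = u \<bullet> half_line_op a b v" for u v
    using symmetric_opD(2)[OF J] inner_push_op[OF i] by (metis half_line_op_def inner_commute)
  moreover have "half_line_op a b (cscale z u) = cscale z (half_line_op a b u)" for z u
    by (rule l2_eqI) (simp add: coord_half_line_op algebra_simps)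
  ultimately show ?thesis unfolding complex_linear_symmetric_def symmetric_op_def by blast
qed

section \<open>Spectrum and eigenspaces of the one-sided Jacobi matrix\<close>

lemma jacobi_one_sided_coord:
  "jacobi_one_sided a b (coord (push_op Suc v)) = coord (push_op Suc (half_line_op a b v))"
proof
  fix n
  have c: "coord (push_op Suc w) n = (if n = 0 then 0 else coord w (n - 1))" for w n
    using coord_push_op_range[OF inj_Suc, of w "n - 1"] coord_push_op[OF inj_Suc, of w 0] by (cases n) auto
  show "jacobi_one_sided a b (coord (push_op Suc v)) n = coord (push_op Suc (half_line_op a b v)) n"
    by (cases "n = 0 \<or> n = 1") (auto simp: jacobi_one_sided_def c coord_half_line_op numeral_2_eq_2)
qed

lemma spectrum_one_sided_iff:
  "z \<in> spectrum {1..} (jacobi_one_sided a b) \<longleftrightarrow> \<not> bounded_below (\<lambda>u. half_line_op a b u - cscale z u)"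
proof -
  have "range Suc = {1..}" by (auto simp: image_iff Suc_le_eq gr0_conv_Suc)
  then show ?thesis
    using spectrum_iff_not_bounded_below[OF inj_Suc complex_linear_symmetric_half_line_op jacobi_one_sided_coord] by simp
qed

text \<open>Each row of the eigenvalue equation is solved for the next coordinate, which is possible
  because the off-diagonal entries are positive; a zero start therefore propagates.\<close>

lemma half_line_eigenvector_zero:
  assumes v: "half_line_op a b v = cscale z v" "coord v 0 = 0"
  shows "v = 0"
proof -
  have "coord v n = 0" for n
  proof (induction n rule: less_induct)
    case (less n)
    show ?case
    proof (cases n)
      case (Suc m)
      have "of_real (a (Suc m)) * coord v (Suc m) = (z - of_real (b (Suc m))) * coord v m
          - (if m = 0 then 0 else of_real (a m) * coord v (m - 1))"
        using arg_cong[OF v(1), of "\<lambda>x. coord x m"]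
        by (simp add: coord_half_line_op algebra_simps split: if_splits)
      also have "\<dots> = 0" using less.IH[of m] less.IH[of "m - 1"] Suc by simp
      finally show ?thesis using pos[of "Suc m"] Suc by simp
    qed (simp add: v(2))
  qed
  then show ?thesis by (intro l2_eqI) simp
qed

text \<open>The multiple of \<open>v\<close> is chosen so that the difference vanishes at site 1;
  the difference is an eigenvector and hence zero.\<close>

lemma half_line_eigenvectors_proportional:
  assumes v: "half_line_op a b v = cscale z v" "v \<noteq> 0" and w: "half_line_op a b w = cscale z w"
  shows "coord v 0 \<noteq> 0" "w = cscale (coord w 0 / coord v 0) v"
proof -
  show v0: "coord v 0 \<noteq> 0" using half_line_eigenvector_zero[OF v(1)] v(2) by blast
  let ?c = "coord w 0 / coord v 0"
  note S = complex_linear_symmetric_half_line_op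
  interpret S: bounded_linear "half_line_op a b"
    using S unfolding complex_linear_symmetric_def symmetric_op_def by blast
  have "half_line_op a b (w - cscale ?c v) = cscale z w - cscale ?c (cscale z v)"
    using S v(1) w unfolding complex_linear_symmetric_def by (simp add: S.diff)
  also have "\<dots> = cscale z (w - cscale ?c v)" by (rule l2_eqI) (simp add: algebra_simps)
  finally have "w - cscale ?c v = 0" using v0 by (intro half_line_eigenvector_zero) auto
  then show "w = cscale ?c v" by simp
qed

lemma eigenspace_one_sided:
  "eigenspace {1..} (jacobi_one_sided a b) z = {coord (push_op Suc v) |v. half_line_op a b v = cscale z v}"
proof -
  have I: "range Suc = {1..}" by (auto simp: image_iff Suc_le_eq gr0_conv_Suc)
  have "jacobi_one_sided a b (coord (push_op Suc v)) = (\<lambda>i. z * coord (push_op Suc v) i)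
      \<longleftrightarrow> half_line_op a b v = cscale z v" for v
  proof -
    have "(\<lambda>i. z * coord (push_op Suc v) i) = coord (push_op Suc (cscale z v))"
      by (rule ext) (simp add: coord_push_op)
    then show ?thesis
      unfolding jacobi_one_sided_coord by (metis coord_inject pull_push_op[OF inj_Suc])
  qed
  then show ?thesis
    unfolding eigenspace_def I[symmetric]
    using ell2_as_coord_push[OF inj_Suc] coord_push_in_ell2(1)[OF inj_Suc] by blast
qed

lemma finite_dim_eigenspace_one_sided:
  shows "finite_dim (eigenspace {1..} (jacobi_one_sided a b) z)"
proof (cases "\<exists>v. half_line_op a b v = cscale z v \<and> v \<noteq> 0")
  case True
  then obtain v where v: "half_line_op a b v = cscale z v" "v \<noteq> 0" by blast
  have "\<exists>c. coord (push_op Suc w) = (\<lambda>i. \<Sum>f\<in>{coord (push_op Suc v)}. c f * f i)"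
    if w: "half_line_op a b w = cscale z w" for w
  proof (intro exI[of _ "\<lambda>_. coord w 0 / coord v 0"] ext)
    fix i
    have "coord (push_op Suc w) i = coord (push_op Suc (cscale (coord w 0 / coord v 0) v)) i"
      using half_line_eigenvectors_proportional(2)[OF v w] by simp
    then show "coord (push_op Suc w) i = (\<Sum>f\<in>{coord (push_op Suc v)}. coord w 0 / coord v 0 * f i)"
      by (simp add: coord_push_op)
  qed
  then show ?thesis
    unfolding finite_dim_def eigenspace_one_sided using v by (intro exI[of _ "{coord (push_op Suc v)}"]) blast
next
  case False
  have "coord (push_op Suc w) = (\<lambda>i. \<Sum>f\<in>{}. c f * f i)" if "half_line_op a b w = cscale z w" for w c
    using False that by (intro ext) (auto simp: coord_push_op)
  then show ?thesis
    unfolding finite_dim_def eigenspace_one_sided by (intro exI[of _ "{}"]) blast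
qed

lemma eigenspace_one_sided_nontrivial_iff:
  "eigenspace {1..} (jacobi_one_sided a b) z \<noteq> {\<lambda>_. 0} \<longleftrightarrow> (\<exists>v. v \<noteq> 0 \<and> half_line_op a b v = cscale z v)"
proof -
  have 0: "coord (push_op Suc (0 :: nat l2)) = (\<lambda>_. 0)" by (rule ext) (simp add: coord_push_op)
  then have iff: "coord (push_op Suc v) = (\<lambda>_. 0) \<longleftrightarrow> v = 0" for v :: "nat l2"
    by (metis coord_inject pull_push_op[OF inj_Suc])
  have "half_line_op a b 0 = cscale z 0"
    by (rule l2_eqI) (simp add: coord_half_line_op)
  then have "(\<lambda>_. 0) \<in> eigenspace {1..} (jacobi_one_sided a b) z"
    unfolding eigenspace_one_sided using 0 by (intro CollectI exI[of _ 0]) simp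
  then have "eigenspace {1..} (jacobi_one_sided a b) z \<noteq> {\<lambda>_. 0}
      \<longleftrightarrow> (\<exists>x\<in>eigenspace {1..} (jacobi_one_sided a b) z. x \<noteq> (\<lambda>_. 0))" by blast
  also have "\<dots> \<longleftrightarrow> (\<exists>v. v \<noteq> 0 \<and> half_line_op a b v = cscale z v)"
    unfolding eigenspace_one_sided using iff by (simp add: Bex_def) metis
  finally show ?thesis .
qed

section \<open>Essential spectrum of the one-sided Jacobi matrix\<close>

lemma truncation_compact:
  fixes u :: "nat \<Rightarrow> nat l2"
  assumes "\<And>k. norm (u k) = 1"
  shows "\<exists>s. strict_mono (s :: nat \<Rightarrow> nat) \<and> convergent (\<lambda>k. mul_op (indicator {..N}) (u (s k)))"
proof -
  have "norm (coord (u k) i) \<le> 1" for k i using l2_coord_le[of "u k" i] assms[of k] by simp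
  \<comment> \<open>A diagonal subsequence along which every coordinate converges; after truncation
    only finitely many matter, so the convergence is in norm.\<close>
  then obtain s where s: "strict_mono (s :: nat \<Rightarrow> nat)" "\<And>i. \<exists>l. (\<lambda>k. coord (u (s k)) i) \<longlonglongrightarrow> l"
    using function_convergent_subsequence[of UNIV "\<lambda>k. coord (u k)" 1] by (metis UNIV_I countableI_type)
  then obtain l where l: "\<And>i. (\<lambda>k. coord (u (s k)) i) \<longlonglongrightarrow> l i" by metis
  define y where "y = Abs_l2 (\<lambda>i. if i \<le> N then l i else 0)"
  have "(\<lambda>i. (cmod (if i \<le> N then l i else 0))\<^sup>2) summable_on {..N}" by simp
  then have "(\<lambda>i. (cmod (if i \<le> N then l i else 0))\<^sup>2) summable_on UNIV"
    by (rule summable_on_cong_neutral[THEN iffD1, rotated -1]) auto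
  then have "(\<lambda>i. if i \<le> N then l i else 0) \<in> ell2 UNIV"
    unfolding ell2_UNIV_iff .
  then have y: "coord y i = (if i \<le> N then l i else 0)" for i by (simp add: y_def coord_Abs_l2)
  have "(norm (mul_op (indicator {..N}) (u (s k)) - y))\<^sup>2 = (\<Sum>i\<le>N. (cmod (coord (u (s k)) i - l i))\<^sup>2)" for k
    by (subst l2_norm_sq_finite[of "{..N}"]) (auto simp: y)
  moreover have "(\<lambda>k. \<Sum>i\<le>N. (cmod (coord (u (s k)) i - l i))\<^sup>2) \<longlonglongrightarrow> (\<Sum>i\<le>N. (cmod (l i - l i))\<^sup>2)"
    by (intro tendsto_intros l)
  ultimately have "(\<lambda>k. (norm (mul_op (indicator {..N}) (u (s k)) - y))\<^sup>2) \<longlonglongrightarrow> 0" by simp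
  then have "(\<lambda>k. norm (mul_op (indicator {..N}) (u (s k)) - y)) \<longlonglongrightarrow> 0"
    using tendsto_real_sqrt by fastforce
  then have "(\<lambda>k. mul_op (indicator {..N}) (u (s k))) \<longlonglongrightarrow> y"
    by (simp add: tendsto_norm_zero_iff LIM_zero_iff)
  then show ?thesis using s(1) convergent_def by blast
qed

text \<open>An estimate modulo the truncation to finitely many sites would make \<open>z\<close> an
  isolated eigenvalue, of finite multiplicity because eigenvectors are proportional, and so put it
  into the discrete spectrum.\<close>

lemma essential_spectrum_no_a_priori_estimate:
  assumes z: "z \<in> essential_spectrum {1..} (jacobi_one_sided a b)"
  shows "Im z = 0"
    and "\<exists>u. norm u > C * (norm (half_line_op a b u - cscale z u) + norm (mul_op (indicator {..N}) u))"
proof -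
  note S = complex_linear_symmetric_half_line_op
  have zs: "z \<in> spectrum {1..} (jacobi_one_sided a b)" "z \<notin> discrete_spectrum {1..} (jacobi_one_sided a b)"
    using z by (auto simp: essential_spectrum_def)
  have nbb: "\<not> bounded_below (\<lambda>u. half_line_op a b u - cscale z u)"
    using zs(1) spectrum_one_sided_iff by blast
  show im: "Im z = 0" using spectrum_point_real[OF S nbb] .
  then have zr: "z = of_real (Re z)" by (simp add: complex_eq_iff)
  show "\<exists>u. norm u > C * (norm (half_line_op a b u - cscale z u) + norm (mul_op (indicator {..N}) u))"
  proof (rule ccontr)
    assume "\<not> ?thesis"
    then have est: "norm u \<le> C * (norm (half_line_op a b u - Re z *\<^sub>R u) + norm (mul_op (indicator {..N}) u))" for u
      unfolding cscale_real[OF im] by (metis not_le)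
    have nbb': "\<not> bounded_below (\<lambda>u. half_line_op a b u - Re z *\<^sub>R u)"
      using nbb unfolding cscale_real[OF im] .
    have sym: "symmetric_op (\<lambda>u. half_line_op a b u - Re z *\<^sub>R u)"
      using S symmetric_op_shift unfolding complex_linear_symmetric_def by blast
    note iso = isolated_eigenvalue_of_a_priori_estimate[OF sym bounded_linear_mul_indicator truncation_compact est nbb']
    obtain w where "w \<noteq> 0" "half_line_op a b w = Re z *\<^sub>R w" using iso(1) by auto
    then have "eigenspace {1..} (jacobi_one_sided a b) z \<noteq> {\<lambda>_. 0}"
      unfolding eigenspace_one_sided_nontrivial_iff cscale_real[OF im] by blast
    moreover obtain d where d: "d > 0" "\<And>t. 0 < \<bar>t\<bar> \<Longrightarrow> \<bar>t\<bar> < d \<Longrightarrow>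
        bounded_below (\<lambda>u. half_line_op a b u - Re z *\<^sub>R u - t *\<^sub>R u)"
      using iso(2) by blast
    have "w = z" if w: "w \<in> ball z d" "w \<in> spectrum {1..} (jacobi_one_sided a b)" for w
    proof (rule ccontr)
      assume "w \<noteq> z"
      have nb: "\<not> bounded_below (\<lambda>u. half_line_op a b u - cscale w u)"
        using w(2) spectrum_one_sided_iff by blast
      then have wr: "w = of_real (Re w)" using spectrum_point_real[OF S] by (simp add: complex_eq_iff)
      let ?t = "Re w - Re z"
      have "dist z w = \<bar>?t\<bar>" by (subst zr, subst wr) (simp add: dist_norm flip: of_real_diff)
      then have "\<bar>?t\<bar> < d" using w(1) by simp
      moreover have "0 < \<bar>?t\<bar>" using \<open>w \<noteq> z\<close> zr wr by (metis eq_iff_diff_eq_0 zero_less_abs_iff)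
      moreover have shift: "half_line_op a b u - Re z *\<^sub>R u - ?t *\<^sub>R u = half_line_op a b u - cscale w u" for u
        by (subst wr, unfold cscale_of_real) (simp add: algebra_simps)
      ultimately show False using d(2)[of ?t] nb unfolding shift by blast
    qed
    then have "ball z d \<inter> spectrum {1..} (jacobi_one_sided a b) = {z}" using zs(1) d(1) by auto
    then have "z isolated_in spectrum {1..} (jacobi_one_sided a b)"
      unfolding isolated_in_def using zs(1) open_ball by blast
    ultimately show False
      using zs(2) finite_dim_eigenspace_one_sided unfolding discrete_spectrum_def by blast
  qed
qed

text \<open>\<open>p > N \<ge> 0\<close> makes the entries of the two-sided extension at nonpositive indices irrelevant.\<close>

lemma essential_spectrum_approx_eigenvector:
  assumes z: "z \<in> essential_spectrum {1..} (jacobi_one_sided a b)"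
    and e: "e > 0"
  shows "\<exists>p q u. int N < p \<and> approx_eigenvector (\<lambda>n. a (nat n)) (\<lambda>n. b (nat n)) z e p q u"
proof -
  let ?a = "\<lambda>n. a (nat n)" and ?b = "\<lambda>n. b (nat n)" and ?h = half_line_embedding
  note S = complex_linear_symmetric_half_line_op
  let ?D = "\<lambda>u. half_line_op a b u - cscale z u"
  have D: "bounded_linear ?D" by (rule bounded_linear_shifted[OF S])
  interpret D: bounded_linear ?D by (rule D)
  interpret P: bounded_linear "mul_op (indicator {..N})" by (rule bounded_linear_mul_indicator)
  obtain M where M: "M > 0" "\<And>x. norm (?D x) \<le> norm x * M" using D.pos_bounded by blast
  define d where "d = sqrt e"
  have d: "d > 0" using e by (simp add: d_def)
  \<comment> \<open>Removing the first coordinates of \<open>x\<close> costs at most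
    \<open>M\<close> times the removed norm in the residual and \<open>d\<close> times it on the
    right-hand side. This \<open>C\<close> lets the failed estimate absorb both losses and leaves a
    residual below \<open>d * norm y\<close>.\<close>
  define C where "C = (1 + M + d) / d"
  have C: "C > 0" using M(1) d by (simp add: C_def)
  obtain x where "norm x > C * (norm (?D x) + norm (mul_op (indicator {..N}) x))"
    using essential_spectrum_no_a_priori_estimate(2)[OF z] by blast
  then have x: "d * norm x > (1 + M + d) * (norm (?D x) + norm (mul_op (indicator {..N}) x))"
    using d by (simp add: C_def field_simps)
  define y where "y = x - mul_op (indicator {..N}) x"
  have "norm (?D y) < d * norm y"
  proof -
    let ?m = "norm (mul_op (indicator {..N}) x)"
    have "norm (?D y) \<le> norm (?D x) + M * ?m"
      using norm_triangle_ineq4[of "?D x" "?D (mul_op (indicator {..N}) x)"] M(2)[of "mul_op (indicator {..N}) x"]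
      unfolding y_def D.diff by (simp add: mult.commute)
    moreover have "d * norm x \<le> d * norm y + d * ?m"
      using norm_triangle_ineq2[of x "mul_op (indicator {..N}) x"] d unfolding y_def
      by (simp flip: distrib_left)
    moreover have "norm (?D x) + M * ?m + d * ?m \<le> (1 + M + d) * (norm (?D x) + ?m)"
      using M(1) d by (simp add: algebra_simps)
    ultimately show ?thesis using x by linarith
  qed
  then obtain F where F: "finite F" "norm (?D (mul_op (indicator F) y)) < d * norm (mul_op (indicator F) y)"
    using finite_truncation_approximate_kernel[OF D] by blast
  let ?w = "mul_op (indicator F) y"
  have w0: "?w \<noteq> 0" using F(2) D.zero by auto
  \<comment> \<open>Inserting 0 keeps \<open>Max\<close> meaningful if \<open>F\<close> is
    empty.\<close>
  have supp: "coord ?w n = 0" if "n \<le> N \<or> n > Max (insert 0 F)" for n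
    using that F(1) by (auto simp: y_def indicator_def)
  let ?x = "push_op ?h ?w"
  have c: "coord ?x n = (if n \<ge> 1 then coord ?w (nat (n - 1)) else 0)" for n
    using coord_push_op_range[OF inj_half_line_embedding, of ?w "nat (n - 1)"]
      coord_push_op[OF inj_half_line_embedding, of ?w n]
    by (auto simp: range_half_line_embedding half_line_embedding_def)
  \<comment> \<open>Off the half-line only row 0 could be nonzero, through the value at site 1, that
    is coordinate 0 of \<open>?w\<close>; this coordinate has been cut away. So passing to the
    half-line loses no part of the residual.\<close>
  have "jacobi_op ?a ?b ?x - cscale z ?x = push_op ?h (pull_op ?h (jacobi_op ?a ?b ?x - cscale z ?x))"
  proof (rule push_pull_op[OF inj_half_line_embedding, symmetric])
    fix n assume "n \<notin> range ?h"
    then show "coord (jacobi_op ?a ?b ?x - cscale z ?x) n = 0"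
      using supp[of 0] by (auto simp: range_half_line_embedding ext.coord_jacobi_op jacobi_two_sided_def c)
  qed
  also have "pull_op ?h (jacobi_op ?a ?b ?x - cscale z ?x) = ?D ?w"
    using inj_half_line_embedding by (intro l2_eqI) (simp add: half_line_op_def coord_pull_op)
  finally have nD: "norm (jacobi_op ?a ?b ?x - cscale z ?x) = norm (?D ?w)"
    by (simp add: norm_push_op[OF inj_half_line_embedding])
  have "\<exists>u. approx_eigenvector ?a ?b z (d\<^sup>2) (int N + 1) (int (Max (insert 0 F)) + 1) u"
  proof (rule ext.approx_eigenvector_of_l2)
    show "coord ?x n = 0" if "n \<notin> {int N + 1..int (Max (insert 0 F)) + 1}" for n
    proof (cases "n \<ge> 1")
      case True
      then have "nat (n - 1) \<le> N \<or> nat (n - 1) > Max (insert 0 F)" using that by simp linarith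
      from supp[OF this] True show ?thesis unfolding c by simp
    qed (simp add: c)
    show "?x \<noteq> 0" using w0 norm_push_op[OF inj_half_line_embedding, of ?w] by force
    show "norm (jacobi_op ?a ?b ?x - cscale z ?x) \<le> d * norm ?x"
      unfolding nD norm_push_op[OF inj_half_line_embedding] using F(2) by simp
  qed
  then show ?thesis using e unfolding d_def by (metis less_imp_le real_sqrt_pow2 zless_add1_eq order_refl)
qed

text \<open>The support condition \<open>p \<ge> 2\<close> is used as vanishing at site 1. At an
  isolated eigenvalue, a good approximate eigenvector is close to a true one, whose norm is
  controlled by its value at site 1; that value is nearly zero, which contradicts the norm
  1.\<close>

lemma approx_eigenvector_essential_spectrum:
  assumes ap: "\<And>e. e > 0 \<Longrightarrow> \<exists>p q u. p \<ge> 2 \<and> approx_eigenvector (\<lambda>n. a (nat n)) (\<lambda>n. b (nat n)) z e p q u"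
  shows "z \<in> essential_spectrum {1..} (jacobi_one_sided a b)"
proof -
  let ?a = "\<lambda>n. a (nat n)" and ?b = "\<lambda>n. b (nat n)" and ?h = half_line_embedding
  note S = complex_linear_symmetric_half_line_op
  let ?D = "\<lambda>u. half_line_op a b u - cscale z u"
  have ex: "\<exists>w. norm w = 1 \<and> coord w 0 = 0 \<and> norm (?D w) \<le> e" if e: "e > 0" for e
  proof -
    obtain p q u where u: "p \<ge> 2" "approx_eigenvector ?a ?b z (e\<^sup>2) p q u" using ap[of "e\<^sup>2"] e by auto
    from ext.l2_of_approx_eigenvector[OF u(2)] obtain x where
      x: "coord x = u" "norm x = 1" "norm (jacobi_op ?a ?b x - cscale z x) \<le> e"
      using e by (metis real_sqrt_unique less_imp_le)
    have supp: "coord x n = 0" if "n < 2" for n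
      using u that unfolding approx_eigenvector_def x(1) by auto
    let ?w = "pull_op ?h x"
    have p: "push_op ?h ?w = x"
      by (rule push_pull_op[OF inj_half_line_embedding]) (auto simp: range_half_line_embedding intro: supp)
    have "?D ?w = pull_op ?h (jacobi_op ?a ?b x - cscale z x)"
      using inj_half_line_embedding by (intro l2_eqI) (simp add: half_line_op_def coord_pull_op p)
    then have "norm (?D ?w) \<le> e"
      using norm_pull_op_le[OF inj_half_line_embedding] x(3) order_trans by metis
    moreover have "norm ?w = 1" using norm_push_op[OF inj_half_line_embedding, of ?w] p x(2) by simp
    moreover have "coord ?w 0 = 0"
      using supp[of 1] by (simp add: coord_pull_op[OF inj_half_line_embedding] half_line_embedding_def)
    ultimately show ?thesis by blast
  qed
  have nbb: "\<not> bounded_below ?D"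
  proof
    assume "bounded_below ?D"
    then obtain c where c: "c > 0" "\<And>x. c * norm x \<le> norm (?D x)" unfolding bounded_below_def by blast
    obtain w where "norm w = 1" "norm (?D w) \<le> c / 2" using ex[of "c / 2"] c(1) by auto
    then show False using c(2)[of w] c(1) by simp
  qed
  then have zs: "z \<in> spectrum {1..} (jacobi_one_sided a b)" using spectrum_one_sided_iff by blast
  have im: "Im z = 0" using spectrum_point_real[OF S nbb] .
  then have zr: "z = of_real (Re z)" by (simp add: complex_eq_iff)
  have D: "?D u = half_line_op a b u - Re z *\<^sub>R u" for u
    unfolding cscale_real[OF im] ..
  have "z \<notin> discrete_spectrum {1..} (jacobi_one_sided a b)"
  proof
    assume "z \<in> discrete_spectrum {1..} (jacobi_one_sided a b)"
    then have "z isolated_in spectrum {1..} (jacobi_one_sided a b)"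
      and "eigenspace {1..} (jacobi_one_sided a b) z \<noteq> {\<lambda>_. 0}"
      unfolding discrete_spectrum_def by simp_all
    then obtain U v where U: "open U" "U \<inter> spectrum {1..} (jacobi_one_sided a b) = {z}"
      and v: "half_line_op a b v = cscale z v" "v \<noteq> 0"
      unfolding isolated_in_def eigenspace_one_sided_nontrivial_iff by metis
    obtain d where d: "d > 0" "ball z d \<subseteq> U" using U open_contains_ball by blast
    have sym: "symmetric_op (\<lambda>u. half_line_op a b u - Re z *\<^sub>R u)"
      using S symmetric_op_shift unfolding complex_linear_symmetric_def by blast
    have gap: "bounded_below (\<lambda>u. half_line_op a b u - Re z *\<^sub>R u - t *\<^sub>R u)" if t: "0 < \<bar>t\<bar>" "\<bar>t\<bar> < d" for t
    proof -
      let ?w = "complex_of_real (Re z + t)"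
      have "dist z ?w = \<bar>t\<bar>" by (subst zr) (simp add: dist_norm flip: of_real_diff)
      then have "?w \<in> U" "?w \<noteq> z" using t d(2) by auto
      then have "bounded_below (\<lambda>u. half_line_op a b u - cscale ?w u)"
        using U(2) spectrum_one_sided_iff by blast
      moreover have shift: "half_line_op a b u - Re z *\<^sub>R u - t *\<^sub>R u = half_line_op a b u - cscale ?w u" for u
        unfolding cscale_of_real by (simp add: algebra_simps)
      ultimately show ?thesis unfolding shift by blast
    qed
    \<comment> \<open>By proportionality every eigenvector \<open>u\<close> has norm
      \<open>k\<close> times the modulus of its value at site 1. With the error \<open>c\<close>
      below, \<open>norm (w - u)\<close> is at most \<open>1 / (2 * (k + 1))\<close>, and then
      \<open>norm w \<le> (k + 1) * norm (w - u)\<close> is at most one half.\<close>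
    define k where "k = norm v / cmod (coord v 0)"
    define c where "c = d / (2 * (k + 1))"
    have k: "k \<ge> 0" by (simp add: k_def)
    have "c > 0" using d(1) k by (simp add: c_def)
    then obtain w where w: "norm w = 1" "coord w 0 = 0" "norm (?D w) \<le> c" using ex by blast
    obtain u where u: "half_line_op a b u - Re z *\<^sub>R u = 0" "norm (w - u) \<le> norm (?D w) / d"
      using distance_to_kernel_of_isolated[OF sym d(1) gap, of w] unfolding D by blast
    have close: "norm (w - u) \<le> 1 / (2 * (k + 1))"
    proof -
      have "norm (?D w) / d \<le> c / d" using w(3) d(1) by (intro divide_right_mono) auto
      then show ?thesis using u(2) d(1) by (simp add: c_def)
    qed
    have "half_line_op a b u = cscale z u" using u(1) D[of u] by simp
    from half_line_eigenvectors_proportional(2)[OF v this]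
    have "norm u = norm (cscale (coord u 0 / coord v 0) v)" by simp
    then have "norm u = cmod (coord u 0) * k" by (simp add: norm_cscale k_def norm_divide)
    also have "\<dots> \<le> norm (w - u) * k"
      using l2_coord_le[of "w - u" 0] w(2) k by (intro mult_right_mono) auto
    finally have "norm w \<le> (k + 1) * norm (w - u)"
      using norm_triangle_sub[of w u] by (simp add: algebra_simps)
    also have "\<dots> \<le> (k + 1) * (1 / (2 * (k + 1)))" using close k by (intro mult_left_mono) auto
    finally show False using w(1) k by simp
  qed
  then show ?thesis using zs by (simp add: essential_spectrum_def)
qed

end

section \<open>Localization and right limits\<close>

lemma approx_eigenvector_normalize:
  assumes supp: "\<And>n. n \<notin> {p..q} \<Longrightarrow> u n = 0" and pos: "(\<Sum>n\<in>{p..q}. (cmod (u n))\<^sup>2) > 0"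
    and le: "(\<Sum>n\<in>{p - 1..q + 1}. (cmod (shifted (jacobi_two_sided a b) z u n))\<^sup>2)
      \<le> e * (\<Sum>n\<in>{p..q}. (cmod (u n))\<^sup>2)"
  shows "\<exists>v. approx_eigenvector a b z e p q v"
proof -
  define S where "S = (\<Sum>n\<in>{p..q}. (cmod (u n))\<^sup>2)"
  define c where "c = complex_of_real (1 / sqrt S)"
  have c: "(cmod c)\<^sup>2 = 1 / S" using pos by (simp add: c_def S_def norm_divide power_divide)
  have D: "shifted (jacobi_two_sided a b) z (\<lambda>n. c * u n) n = c * shifted (jacobi_two_sided a b) z u n" for n
    by (simp add: shifted_def jacobi_two_sided_def algebra_simps)
  have "approx_eigenvector a b z e p q (\<lambda>n. c * u n)"
    unfolding approx_eigenvector_def D norm_mult power_mult_distrib sum_distrib_left[symmetric] c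
    using supp pos le by (auto simp: S_def field_simps)
  then show ?thesis by blast
qed

lemma approx_eigenvector_translate:
  assumes "approx_eigenvector a b z e p q u"
  shows "approx_eigenvector (\<lambda>n. a (n + m)) (\<lambda>n. b (n + m)) z e (p - m) (q - m) (\<lambda>n. u (n + m))"
proof -
  have s1: "(\<Sum>n\<in>{p - m..q - m}. (cmod (u (n + m)))\<^sup>2) = (\<Sum>n\<in>{p..q}. (cmod (u n))\<^sup>2)"
    by (rule sum.reindex_bij_witness[of _ "\<lambda>n. n - m" "\<lambda>n. n + m"]) auto
  let ?R = "\<lambda>n. (cmod (shifted (jacobi_two_sided a b) z u n))\<^sup>2"
  have s2: "(\<Sum>n\<in>{p - m - 1..q - m + 1}. ?R (n + m)) = (\<Sum>n\<in>{p - 1..q + 1}. ?R n)"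
    by (rule sum.reindex_bij_witness[of _ "\<lambda>n. n - m" "\<lambda>n. n + m"]) auto
  have "shifted (jacobi_two_sided (\<lambda>n. a (n + m)) (\<lambda>n. b (n + m))) z (\<lambda>n. u (n + m)) n
      = shifted (jacobi_two_sided a b) z u (n + m)" for n
    by (simp add: shifted_def jacobi_two_sided_def algebra_simps)
  then show ?thesis
    using assms s1 s2 unfolding approx_eigenvector_def by auto
qed

text \<open>Counts window positions: between two neighbouring sites the cut-off jumps only for the
  window that begins there and the one that ends there.\<close>

lemma sum_of_bool_le:
  fixes x y :: "'a"
  assumes "finite F"
  shows "(\<Sum>k\<in>F. of_bool (k = x \<or> k = y)) \<le> (2 :: real)"
proof -
  have "(\<Sum>k\<in>F. of_bool (k = x \<or> k = y)) \<le> (\<Sum>k\<in>F. of_bool (k = x) + of_bool (k = y) :: real)"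
    by (intro sum_mono) auto
  also have "\<dots> \<le> 2"
    using assms by (simp add: sum.distrib of_bool_def sum.delta)
  finally show ?thesis .
qed

lemma norm_add_sq_le: "(norm (x + y))\<^sup>2 \<le> 2 * (norm x)\<^sup>2 + 2 * (norm y)\<^sup>2"
  using norm_triangle_ineq[of x y] sum_squares_bound[of "norm x" "norm y"]
  by (smt (verit) norm_ge_zero power2_sum power_mono)

text \<open>Summing over all translates of a sharp window of length \<open>L\<close>, the commutator with the cut-off
  contributes \<open>O(1)\<close> while the mass is counted \<open>L\<close> times; so some window is good.\<close>

lemma (in bounded_jacobi) window_localization:
  fixes L :: int
  assumes u: "approx_eigenvector a b z e p q u" and L: "L \<ge> 1"
  shows "\<exists>k v. p - L < k \<and> approx_eigenvector a b z (2 * e + 16 * K\<^sup>2 / L) k (k + L - 1) v"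
proof -
  \<comment> \<open>The cut-off is sharp, so it equals its own square and the masses of the windows
    add up to exactly \<open>L\<close>.\<close>
  define \<phi> where "\<phi> k n = (of_bool (k \<le> n \<and> n < k + L) :: real)" for k n :: int
  define w where "w k n = of_real (\<phi> k n) * u n" for k n
  \<comment> \<open>The commutator of the Jacobi matrix with the cut-off, applied to
    \<open>u\<close>; it is nonzero only at the edges of the window.\<close>
  define c where "c k n = of_real (a n * (\<phi> k (n + 1) - \<phi> k n)) * u (n + 1)
    + of_real (a (n - 1) * (\<phi> k (n - 1) - \<phi> k n)) * u (n - 1)" for k n
  let ?D = "shifted (jacobi_two_sided a b) z"
  \<comment> \<open>Contains the position of every window that meets the support of
    \<open>u\<close>.\<close>
  define F where "F = {p - L..q + L}"
  define G where "G = {p - 1..q + 1}"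
  define E where "E k = (\<Sum>n\<in>G. (cmod (?D (w k) n))\<^sup>2)" for k
  define N where "N k = (\<Sum>n\<in>{p..q}. (cmod (w k n))\<^sup>2)" for k
  \<comment> \<open>The 2 and one factor 2 in 16 come from splitting the square of a sum. The rest
    of 16 is 2 for the two terms of the commutator, 2 for the two jumps, and 2 for the masses of the
    two shifted copies of \<open>u\<close>.\<close>
  define C where "C = 2 * e + 16 * K\<^sup>2 / L"
  have supp: "u n = 0" if "n \<notin> {p..q}" for n using u that unfolding approx_eigenvector_def by blast
  have one: "(\<Sum>n\<in>{p..q}. (cmod (u n))\<^sup>2) = 1" and De: "(\<Sum>n\<in>G. (cmod (?D u n))\<^sup>2) \<le> e"
    using u unfolding approx_eigenvector_def G_def by auto
  have K: "K \<ge> 0" using bnd(1)[of 0] by simp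
  have \<phi>: "0 \<le> \<phi> k n" "\<phi> k n \<le> 1" "(\<phi> k n)\<^sup>2 = \<phi> k n" for k n by (auto simp: \<phi>_def)
  have \<phi>_sum: "(\<Sum>k\<in>F. \<phi> k n) \<le> L" for n
  proof -
    have "(\<Sum>k\<in>F. \<phi> k n) = (\<Sum>k\<in>F \<inter> {n - L + 1..n}. 1)"
      unfolding \<phi>_def F_def by (intro sum.mono_neutral_cong_right) auto
    also have "\<dots> \<le> real (card {n - L + 1..n})"
      using card_mono[of "{n - L + 1..n}" "F \<inter> {n - L + 1..n}"] by simp
    finally show ?thesis using L by simp
  qed
  have \<phi>_sum_eq: "(\<Sum>k\<in>F. \<phi> k n) = L" if "n \<in> {p..q}" for n
  proof -
    have "(\<Sum>k\<in>F. \<phi> k n) = (\<Sum>k\<in>{n - L + 1..n}. 1)"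
      unfolding \<phi>_def F_def using that L by (intro sum.mono_neutral_cong_right) auto
    then show ?thesis using L by simp
  qed
  have jump: "(\<phi> k (n + 1) - \<phi> k n)\<^sup>2 = of_bool (k = n + 1 \<or> k = n + 1 - L)"
    "(\<phi> k (n - 1) - \<phi> k n)\<^sup>2 = of_bool (k = n \<or> k = n - L)" for k n
    using L by (auto simp: \<phi>_def)
  have split: "?D (w k) n = of_real (\<phi> k n) * ?D u n + c k n" for k n
    by (simp add: shifted_def jacobi_two_sided_def w_def c_def algebra_simps)
  have c_bound: "(cmod (c k n))\<^sup>2 \<le> 2 * K\<^sup>2 * ((\<phi> k (n + 1) - \<phi> k n)\<^sup>2 * (cmod (u (n + 1)))\<^sup>2
      + (\<phi> k (n - 1) - \<phi> k n)\<^sup>2 * (cmod (u (n - 1)))\<^sup>2)" for k n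
  proof -
    have *: "(cmod (of_real (a m * t) * x))\<^sup>2 \<le> K\<^sup>2 * (t\<^sup>2 * (cmod x)\<^sup>2)" for m :: int and t x
    proof -
      have "(a m)\<^sup>2 \<le> K\<^sup>2" using bnd(1)[of m] by (metis abs_ge_zero power2_abs power_mono)
      then have "(a m)\<^sup>2 * (t\<^sup>2 * (cmod x)\<^sup>2) \<le> K\<^sup>2 * (t\<^sup>2 * (cmod x)\<^sup>2)" by (intro mult_right_mono) auto
      then show ?thesis by (simp add: norm_mult power_mult_distrib mult.assoc)
    qed
    show ?thesis
      unfolding c_def
      by (rule order_trans[OF norm_add_sq_le])
        (use *[of n "\<phi> k (n + 1) - \<phi> k n" "u (n + 1)"] *[of "n - 1" "\<phi> k (n - 1) - \<phi> k n" "u (n - 1)"]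
          in \<open>simp add: distrib_left\<close>)
  qed
  have jump_sum: "(\<Sum>k\<in>F. (\<phi> k (n + 1) - \<phi> k n)\<^sup>2) \<le> 2" "(\<Sum>k\<in>F. (\<phi> k (n - 1) - \<phi> k n)\<^sup>2) \<le> 2" for n
    unfolding jump by (intro sum_of_bool_le; simp add: F_def)+
  have c_sum: "(\<Sum>k\<in>F. (cmod (c k n))\<^sup>2) \<le> 4 * K\<^sup>2 * ((cmod (u (n + 1)))\<^sup>2 + (cmod (u (n - 1)))\<^sup>2)" for n
  proof -
    have "(\<Sum>k\<in>F. (cmod (c k n))\<^sup>2) \<le> (\<Sum>k\<in>F. 2 * K\<^sup>2 * ((\<phi> k (n + 1) - \<phi> k n)\<^sup>2 * (cmod (u (n + 1)))\<^sup>2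
      + (\<phi> k (n - 1) - \<phi> k n)\<^sup>2 * (cmod (u (n - 1)))\<^sup>2))"
      by (intro sum_mono c_bound)
    also have "\<dots> = 2 * K\<^sup>2 * ((\<Sum>k\<in>F. (\<phi> k (n + 1) - \<phi> k n)\<^sup>2) * (cmod (u (n + 1)))\<^sup>2
      + (\<Sum>k\<in>F. (\<phi> k (n - 1) - \<phi> k n)\<^sup>2) * (cmod (u (n - 1)))\<^sup>2)"
      by (simp add: sum_distrib_left sum_distrib_right sum.distrib distrib_left)
    also have "\<dots> \<le> 2 * K\<^sup>2 * (2 * (cmod (u (n + 1)))\<^sup>2 + 2 * (cmod (u (n - 1)))\<^sup>2)"
      by (intro mult_left_mono add_mono mult_right_mono jump_sum) auto
    finally show ?thesis by (simp add: algebra_simps)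
  qed
  have shift_sum: "(\<Sum>n\<in>G. (cmod (u (n + d)))\<^sup>2) \<le> 1" if "d = 1 \<or> d = - 1" for d
  proof -
    have "(\<Sum>n\<in>G. (cmod (u (n + d)))\<^sup>2) = (\<Sum>n\<in>{p - 1 + d..q + 1 + d}. (cmod (u n))\<^sup>2)"
      unfolding G_def by (rule sum.reindex_bij_witness[of _ "\<lambda>n. n - d" "\<lambda>n. n + d"]) auto
    also have "\<dots> = (\<Sum>n\<in>{p - 1 + d..q + 1 + d} \<inter> {p..q}. (cmod (u n))\<^sup>2)"
      using supp by (intro sum.mono_neutral_right) auto
    also have "\<dots> \<le> (\<Sum>n\<in>{p..q}. (cmod (u n))\<^sup>2)" by (intro sum_mono2) auto
    finally show ?thesis using one by simp
  qed
  have "(\<Sum>k\<in>F. E k) \<le> (\<Sum>n\<in>G. 2 * L * (cmod (?D u n))\<^sup>2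
      + 8 * K\<^sup>2 * ((cmod (u (n + 1)))\<^sup>2 + (cmod (u (n - 1)))\<^sup>2))"
    unfolding E_def
  proof (subst sum.swap, intro sum_mono)
    fix n
    have "(\<Sum>k\<in>F. (cmod (?D (w k) n))\<^sup>2) \<le> (\<Sum>k\<in>F. 2 * (\<phi> k n * (cmod (?D u n))\<^sup>2) + 2 * (cmod (c k n))\<^sup>2)"
    proof (intro sum_mono)
      fix k
      show "(cmod (?D (w k) n))\<^sup>2 \<le> 2 * (\<phi> k n * (cmod (?D u n))\<^sup>2) + 2 * (cmod (c k n))\<^sup>2"
        unfolding split by (rule order_trans[OF norm_add_sq_le]) (simp add: norm_mult power_mult_distrib \<phi>)
    qed
    also have "\<dots> = 2 * ((\<Sum>k\<in>F. \<phi> k n) * (cmod (?D u n))\<^sup>2) + 2 * (\<Sum>k\<in>F. (cmod (c k n))\<^sup>2)"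
      by (simp add: sum.distrib sum_distrib_left sum_distrib_right)
    also have "\<dots> \<le> 2 * (L * (cmod (?D u n))\<^sup>2)
        + 2 * (4 * K\<^sup>2 * ((cmod (u (n + 1)))\<^sup>2 + (cmod (u (n - 1)))\<^sup>2))"
      by (intro add_mono mult_left_mono mult_right_mono \<phi>_sum c_sum) auto
    finally show "(\<Sum>k\<in>F. (cmod (?D (w k) n))\<^sup>2) \<le> 2 * L * (cmod (?D u n))\<^sup>2
      + 8 * K\<^sup>2 * ((cmod (u (n + 1)))\<^sup>2 + (cmod (u (n - 1)))\<^sup>2)" by simp
  qed
  also have "\<dots> = 2 * L * (\<Sum>n\<in>G. (cmod (?D u n))\<^sup>2)
      + 8 * K\<^sup>2 * ((\<Sum>n\<in>G. (cmod (u (n + 1)))\<^sup>2) + (\<Sum>n\<in>G. (cmod (u (n + - 1)))\<^sup>2))"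
    by (simp add: sum.distrib flip: sum_distrib_left)
  also have "\<dots> \<le> 2 * L * e + 8 * K\<^sup>2 * (1 + 1)"
    using L by (intro add_mono mult_left_mono De shift_sum) auto
  also have "\<dots> = C * L" using L by (simp add: C_def field_simps)
  finally have sumE: "(\<Sum>k\<in>F. E k) \<le> C * L" .
  have "(\<Sum>k\<in>F. N k) = (\<Sum>n\<in>{p..q}. (\<Sum>k\<in>F. \<phi> k n) * (cmod (u n))\<^sup>2)"
    unfolding N_def by (subst sum.swap) (simp add: w_def norm_mult power_mult_distrib \<phi> sum_distrib_right)
  also have "\<dots> = L" using one by (simp add: \<phi>_sum_eq flip: sum_distrib_left)
  finally have sumN: "(\<Sum>k\<in>F. N k) = L" .
  \<comment> \<open>Otherwise \<open>E k \<ge> C * N k\<close> throughout, strictly where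
    \<open>N k > 0\<close>, and summation contradicts \<open>sumE\<close> and
    \<open>sumN\<close>.\<close>
  have "\<exists>k\<in>F. N k > 0 \<and> E k \<le> C * N k"
  proof (rule ccontr)
    assume neg: "\<not> ?thesis"
    have N0: "N k \<ge> 0" and E0: "E k \<ge> 0" for k by (simp_all add: N_def E_def sum_nonneg)
    have le: "C * N k \<le> E k" if "k \<in> F" for k
      using neg that N0[of k] E0[of k] by (cases "N k = 0") force+
    have "\<exists>k\<in>F. N k > 0"
    proof (rule ccontr)
      assume "\<not> (\<exists>k\<in>F. N k > 0)"
      then have "(\<Sum>k\<in>F. N k) \<le> 0" by (intro sum_nonpos) (auto simp: not_less)
      then show False using sumN L by simp
    qed
    then have "(\<Sum>k\<in>F. C * N k) < (\<Sum>k\<in>F. E k)"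
      using neg le by (intro sum_strict_mono_ex1) (auto simp: F_def not_le)
    then show False using sumE sumN by (simp add: sum_distrib_left[symmetric])
  qed
  then obtain k where k: "N k > 0" "E k \<le> C * N k" by blast
  have wsupp: "w k n = 0" if "n \<notin> {k..k + L - 1} \<or> n \<notin> {p..q}" for n
    using that supp[of n] by (auto simp: w_def \<phi>_def)
  \<comment> \<open>A window with positive mass meets the support of \<open>u\<close>, so it moves
    off to infinity together with \<open>p\<close>.\<close>
  have "p - L < k"
  proof (rule ccontr)
    assume "\<not> p - L < k"
    then have "w k n = 0" if "n \<in> {p..q}" for n using that by (intro wsupp) auto
    then show False using k(1) by (simp add: N_def)
  qed
  moreover have N': "N k = (\<Sum>n\<in>{k..k + L - 1}. (cmod (w k n))\<^sup>2)"
    unfolding N_def by (rule sum.mono_neutral_cong) (auto simp: wsupp)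
  moreover have "E k = (\<Sum>n\<in>{k - 1..k + L - 1 + 1}. (cmod (?D (w k) n))\<^sup>2)"
    unfolding E_def G_def
    by (rule sum.mono_neutral_cong)
      (use shifted_jacobi_support[of p q "w k"] shifted_jacobi_support[of k "k + L - 1" "w k"] wsupp in auto)
  ultimately show ?thesis
    using approx_eigenvector_normalize[of k "k + L - 1" "w k" a b z C] wsupp k unfolding C_def by auto
qed

section \<open>Transfer between the half-line matrix and its right limits\<close>

lemma right_limits_bounded:
  assumes "(ar, br) \<in> right_limits a b" "\<And>n. \<bar>a n\<bar> \<le> K" "\<And>n. \<bar>b n\<bar> \<le> K"
  shows "bounded_jacobi ar br K"
proof
  obtain m where m: "\<And>l. (\<lambda>j. a (nat (int (m j) + l))) \<longlonglongrightarrow> ar l" "\<And>l. (\<lambda>j. b (nat (int (m j) + l))) \<longlonglongrightarrow> br l"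
    using assms(1) unfolding right_limits_def by blast
  show "\<bar>ar n\<bar> \<le> K" for n by (rule LIMSEQ_le_const2[OF tendsto_rabs[OF m(1)]]) (use assms(2) in auto)
  show "\<bar>br n\<bar> \<le> K" for n by (rule LIMSEQ_le_const2[OF tendsto_rabs[OF m(2)]]) (use assms(3) in auto)
qed

lemma residual_tendsto:
  assumes "\<And>l. (\<lambda>j. a j l) \<longlonglongrightarrow> a' l" "\<And>l. (\<lambda>j. b j l) \<longlonglongrightarrow> b' l" "\<And>l. (\<lambda>j. u j l) \<longlonglongrightarrow> u' l"
  shows "(\<lambda>j. \<Sum>n\<in>F. (cmod (shifted (jacobi_two_sided (a j) (b j)) z (u j) n))\<^sup>2)
    \<longlonglongrightarrow> (\<Sum>n\<in>F. (cmod (shifted (jacobi_two_sided a' b') z u' n))\<^sup>2)"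
  unfolding shifted_def jacobi_two_sided_def by (intro tendsto_intros assms)

text \<open>The same vector is placed at site \<open>m j\<close>. Only finitely many parameters
  enter its residual, so the residual converges, and the slack between \<open>e\<close> and
  \<open>e'\<close> makes it admissible for large \<open>j\<close>.\<close>

lemma approx_eigenvector_of_right_limit:
  assumes r: "(ar, br) \<in> right_limits a b" and u: "approx_eigenvector ar br z e p q u" and e: "e < e'"
  shows "\<exists>p q u. p \<ge> 2 \<and> approx_eigenvector (\<lambda>n. a (nat n)) (\<lambda>n. b (nat n)) z e' p q u"
proof -
  obtain m :: "nat \<Rightarrow> nat" where m: "strict_mono m" "\<And>l. (\<lambda>j. a (nat (int (m j) + l))) \<longlonglongrightarrow> ar l"
    "\<And>l. (\<lambda>j. b (nat (int (m j) + l))) \<longlonglongrightarrow> br l"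
    using r unfolding right_limits_def by blast
  let ?a = "\<lambda>j l. a (nat (int (m j) + l))" and ?b = "\<lambda>j l. b (nat (int (m j) + l))"
  have "(\<lambda>j. \<Sum>n\<in>{p - 1..q + 1}. (cmod (shifted (jacobi_two_sided (?a j) (?b j)) z u n))\<^sup>2)
    \<longlonglongrightarrow> (\<Sum>n\<in>{p - 1..q + 1}. (cmod (shifted (jacobi_two_sided ar br) z u n))\<^sup>2)"
    by (rule residual_tendsto[where u = "\<lambda>_. u"]) (auto intro: m)
  moreover have "(\<Sum>n\<in>{p - 1..q + 1}. (cmod (shifted (jacobi_two_sided ar br) z u n))\<^sup>2) < e'"
    using u e unfolding approx_eigenvector_def by linarith
  ultimately have "\<forall>\<^sub>F j in sequentially.
      (\<Sum>n\<in>{p - 1..q + 1}. (cmod (shifted (jacobi_two_sided (?a j) (?b j)) z u n))\<^sup>2) < e'"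
    by (rule order_tendstoD)
  \<comment> \<open>Since \<open>m j \<ge> j\<close>, the translated window then starts at site 2 or
    later.\<close>
  moreover have "\<forall>\<^sub>F j in sequentially. j \<ge> nat (2 - p)" by (rule eventually_ge_at_top)
  ultimately obtain j where j: "(\<Sum>n\<in>{p - 1..q + 1}. (cmod (shifted (jacobi_two_sided (?a j) (?b j)) z u n))\<^sup>2) < e'"
    "j \<ge> nat (2 - p)"
    using eventually_happens[OF eventually_conj] by (metis (lifting) sequentially_bot)
  have "approx_eigenvector (?a j) (?b j) z e' p q u"
    using u j(1) unfolding approx_eigenvector_def by simp
  from approx_eigenvector_translate[OF this, of "- int (m j)"]
  have "approx_eigenvector (\<lambda>n. a (nat n)) (\<lambda>n. b (nat n)) z e' (p + int (m j)) (q + int (m j)) (\<lambda>n. u (n - int (m j)))"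
    by simp
  moreover have "p + int (m j) \<ge> 2" using j(2) seq_suble[OF m(1), of j] by linarith
  ultimately show ?thesis by blast
qed

lemma approx_eigenvector_change_point:
  assumes "approx_eigenvector a b z e p q u"
  shows "approx_eigenvector a b z' (2 * e + 2 * (dist z z')\<^sup>2) p q u"
proof -
  let ?D = "\<lambda>z. shifted (jacobi_two_sided a b) z u"
  have supp: "u n = 0" if "n \<notin> {p..q}" for n using assms that unfolding approx_eigenvector_def by blast
  have one: "(\<Sum>n\<in>{p..q}. (cmod (u n))\<^sup>2) = 1" and De: "(\<Sum>n\<in>{p - 1..q + 1}. (cmod (?D z n))\<^sup>2) \<le> e"
    using assms unfolding approx_eigenvector_def by auto
  have "(\<Sum>n\<in>{p - 1..q + 1}. (cmod (?D z' n))\<^sup>2)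
      \<le> (\<Sum>n\<in>{p - 1..q + 1}. 2 * (cmod (?D z n))\<^sup>2 + 2 * ((dist z z')\<^sup>2 * (cmod (u n))\<^sup>2))"
  proof (intro sum_mono)
    fix n
    have "?D z' n = ?D z n + (z - z') * u n" by (simp add: shifted_def algebra_simps)
    then show "(cmod (?D z' n))\<^sup>2 \<le> 2 * (cmod (?D z n))\<^sup>2 + 2 * ((dist z z')\<^sup>2 * (cmod (u n))\<^sup>2)"
      using norm_add_sq_le[of "?D z n" "(z - z') * u n"] by (simp add: norm_mult power_mult_distrib dist_norm)
  qed
  also have "\<dots> = 2 * (\<Sum>n\<in>{p - 1..q + 1}. (cmod (?D z n))\<^sup>2)
      + 2 * ((dist z z')\<^sup>2 * (\<Sum>n\<in>{p - 1..q + 1}. (cmod (u n))\<^sup>2))"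
    by (simp add: sum.distrib sum_distrib_left)
  also have "(\<Sum>n\<in>{p - 1..q + 1}. (cmod (u n))\<^sup>2) = (\<Sum>n\<in>{p..q}. (cmod (u n))\<^sup>2)"
    using supp by (intro sum.mono_neutral_right) auto
  finally show ?thesis using De one supp unfolding approx_eigenvector_def by auto
qed

section \<open>The two inclusions\<close>

context bounded_half_line_jacobi
begin

text \<open>The closure is absorbed by approximate eigenvectors: one for a nearby \<open>z'\<close>
  is also one for \<open>z\<close> with a slightly larger error.\<close>

lemma closure_right_limit_spectra_subset:
  "closure (\<Union>(ar, br)\<in>right_limits a b. spectrum UNIV (jacobi_two_sided ar br))
    \<subseteq> essential_spectrum {1..} (jacobi_one_sided a b)"
proof
  fix z
  assume z: "z \<in> closure (\<Union>(ar, br)\<in>right_limits a b. spectrum UNIV (jacobi_two_sided ar br))"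
  show "z \<in> essential_spectrum {1..} (jacobi_one_sided a b)"
  proof (rule approx_eigenvector_essential_spectrum)
    fix e :: real assume e: "e > 0"
    \<comment> \<open>Error budget: \<open>e / 8\<close> for the right limit, \<open>e / 4\<close>
      after transfer to the half-line, and twice \<open>e / 4\<close> plus twice the squared
      distance, itself at most \<open>e / 4\<close>, after the move to \<open>z\<close>.\<close>
    then obtain ar br z' where r: "(ar, br) \<in> right_limits a b"
      and z': "z' \<in> spectrum UNIV (jacobi_two_sided ar br)" "dist z' z < sqrt (e / 4)"
      using closure_approachableD[OF z, of "sqrt (e / 4)"] by (auto simp: dist_commute)
    interpret r: bounded_jacobi ar br K using right_limits_bounded[OF r bnd] .
    obtain p q u where "approx_eigenvector ar br z' (e / 8) p q u"
      using r.spectrum_two_sided_approx_eigenvector[OF z'(1), of "e / 8"] e by auto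
    from approx_eigenvector_of_right_limit[OF r this, of "e / 4"] e
    obtain p q u where u: "p \<ge> 2" "approx_eigenvector (\<lambda>n. a (nat n)) (\<lambda>n. b (nat n)) z' (e / 4) p q u" by auto
    have "(dist z' z)\<^sup>2 \<le> (sqrt (e / 4))\<^sup>2" using z'(2) by (intro power_mono) auto
    then have "2 * (e / 4) + 2 * (dist z' z)\<^sup>2 \<le> e" using e by simp
    then have "approx_eigenvector (\<lambda>n. a (nat n)) (\<lambda>n. b (nat n)) z e p q u"
      using approx_eigenvector_change_point[OF u(2), of z] unfolding approx_eigenvector_def by auto
    then show "\<exists>p q u. p \<ge> 2 \<and> approx_eigenvector (\<lambda>n. a (nat n)) (\<lambda>n. b (nat n)) z e p q u"
      using u(1) by blast
  qed
qed

text \<open>The window \<open>{0..q}\<close> does not depend on the translation, so no mass escapes: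
  normalization, support and residual bound all pass to the coordinatewise limit.\<close>

lemma right_limit_of_localized_eigenvectors:
  assumes "\<And>N. \<exists>k\<ge>N. \<exists>v. approx_eigenvector (\<lambda>n. a (nat (n + int k))) (\<lambda>n. b (nat (n + int k))) z e 0 q v"
  shows "\<exists>ar br v. (ar, br) \<in> right_limits a b \<and> approx_eigenvector ar br z e 0 q v"
proof -
  define S where "S = {k. \<exists>v. approx_eigenvector (\<lambda>n. a (nat (n + int k))) (\<lambda>n. b (nat (n + int k))) z e 0 q v}"
  have "infinite S" using assms unfolding infinite_nat_iff_unbounded_le S_def by blast
  then obtain r :: "nat \<Rightarrow> nat" where r: "strict_mono r" "\<And>j. r j \<in> S"
    by (metis infinite_enumerate)
  then obtain v where v: "\<And>j. approx_eigenvector (\<lambda>n. a (nat (n + int (r j)))) (\<lambda>n. b (nat (n + int (r j)))) z e 0 q (v j)"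
    unfolding S_def by (simp add: choice_iff) metis
  have v1: "cmod (v j l) \<le> 1" for j l
  proof (cases "l \<in> {0..q}")
    case True
    then have "(cmod (v j l))\<^sup>2 \<le> (\<Sum>n\<in>{0..q}. (cmod (v j n))\<^sup>2)" by (intro member_le_sum) auto
    then have "(cmod (v j l))\<^sup>2 \<le> 1\<^sup>2" using v[of j] unfolding approx_eigenvector_def by simp
    then show ?thesis by (rule power2_le_imp_le) simp
  next
    case False
    then show ?thesis using v[of j] unfolding approx_eigenvector_def by simp
  qed
  \<comment> \<open>Both parameters and the vector are bundled into one bounded sequence of
    functions, so a single diagonal extraction makes all three converge along the same
    subsequence.\<close>
  define f where "f j l = (a (nat (l + int (r j))), b (nat (l + int (r j))), v j l)" for j and l :: int
  have "norm (f j l) \<le> K + (K + 1)" for j l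
    unfolding f_def
    by (intro order_trans[OF norm_Pair_le] add_mono) (use bnd v1 in auto)
  then obtain s g where s: "strict_mono (s :: nat \<Rightarrow> nat)" "\<And>l. (\<lambda>j. f (s j) l) \<longlonglongrightarrow> g l"
    using function_convergent_subsequence[of UNIV f "K + (K + 1)"] by (metis UNIV_I countableI_type)
  define ar br v' where "ar l = fst (g l)" and "br l = fst (snd (g l))" and "v' l = snd (snd (g l))" for l
  have lim: "(\<lambda>j. a (nat (l + int (r (s j))))) \<longlonglongrightarrow> ar l" "(\<lambda>j. b (nat (l + int (r (s j))))) \<longlonglongrightarrow> br l"
    "(\<lambda>j. v (s j) l) \<longlonglongrightarrow> v' l" for l
    using tendsto_fst[OF s(2)[of l]] tendsto_fst[OF tendsto_snd[OF s(2)[of l]]] tendsto_snd[OF tendsto_snd[OF s(2)[of l]]]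
    by (simp_all add: f_def ar_def br_def v'_def)
  have "strict_mono (r \<circ> s)" using r(1) s(1) by (rule strict_mono_o)
  then have "(ar, br) \<in> right_limits a b"
    unfolding right_limits_def using lim(1,2) by (auto simp: add.commute intro!: exI[of _ "r \<circ> s"])
  moreover have "approx_eigenvector ar br z e 0 q v'"
    unfolding approx_eigenvector_def
  proof (intro conjI allI impI)
    fix n assume "n \<notin> {0..q}"
    then have "v (s j) n = 0" for j using v[of "s j"] unfolding approx_eigenvector_def by blast
    then show "v' n = 0" using lim(3)[of n] by (simp add: LIMSEQ_const_iff)
  next
    have "(\<lambda>j. \<Sum>n\<in>{0..q}. (cmod (v (s j) n))\<^sup>2) \<longlonglongrightarrow> (\<Sum>n\<in>{0..q}. (cmod (v' n))\<^sup>2)"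
      by (intro tendsto_intros lim)
    moreover have "(\<Sum>n\<in>{0..q}. (cmod (v (s j) n))\<^sup>2) = 1" for j
      using v[of "s j"] unfolding approx_eigenvector_def by blast
    ultimately show "(\<Sum>n\<in>{0..q}. (cmod (v' n))\<^sup>2) = 1" by (simp add: LIMSEQ_const_iff)
  next
    show "(\<Sum>n\<in>{0 - 1..q + 1}. (cmod (shifted (jacobi_two_sided ar br) z v' n))\<^sup>2) \<le> e"
      by (rule LIMSEQ_le_const2[OF residual_tendsto[OF lim]])
        (use v in \<open>auto simp: approx_eigenvector_def\<close>)
  qed
  ultimately show ?thesis by blast
qed

lemma essential_spectrum_subset:
  "essential_spectrum {1..} (jacobi_one_sided a b)
    \<subseteq> closure (\<Union>(ar, br)\<in>right_limits a b. spectrum UNIV (jacobi_two_sided ar br))"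
proof
  fix z assume z: "z \<in> essential_spectrum {1..} (jacobi_one_sided a b)"
  have im: "Im z = 0" using essential_spectrum_no_a_priori_estimate(1)[OF z] .
  show "z \<in> closure (\<Union>(ar, br)\<in>right_limits a b. spectrum UNIV (jacobi_two_sided ar br))"
    unfolding closure_approachable
  proof (intro allI impI)
    fix d :: real assume d: "d > 0"
    \<comment> \<open>The localized error will be \<open>3 * e\<close>, and the square root of
      \<open>3 * d^2 / 16\<close> is below \<open>d\<close>.\<close>
    define e where "e = d\<^sup>2 / 16"
    have e: "e > 0" using d by (simp add: e_def)
    obtain L0 :: nat where L0: "16 * K\<^sup>2 / e < real L0" using reals_Archimedean2 by blast
    \<comment> \<open>The length depends on \<open>e\<close> alone, hence is common to all
      \<open>N\<close>; it makes the localization cost at most \<open>e\<close>.\<close>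
    define L where "L = int L0 + 1"
    have L: "L \<ge> 1" "16 * K\<^sup>2 / L \<le> e"
      using L0 e by (auto simp: L_def field_simps intro: order_trans[OF less_imp_le])
    have "\<exists>k\<ge>N. \<exists>v. approx_eigenvector (\<lambda>n. a (nat (n + int k))) (\<lambda>n. b (nat (n + int k))) z (3 * e) 0 (L - 1) v" for N
    proof -
      \<comment> \<open>The localized window may start up to \<open>L\<close> sites before
        \<open>p\<close>; the margin \<open>nat L\<close> still leaves it beyond
        \<open>N\<close>.\<close>
      obtain p q u where u: "int (N + nat L) < p" "approx_eigenvector (\<lambda>n. a (nat n)) (\<lambda>n. b (nat n)) z e p q u"
        using essential_spectrum_approx_eigenvector[OF z e] by blast
      then obtain k v where k: "p - L < k"
        "approx_eigenvector (\<lambda>n. a (nat n)) (\<lambda>n. b (nat n)) z (2 * e + 16 * K\<^sup>2 / L) k (k + L - 1) v"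
        using ext.window_localization[OF u(2) L(1)] by blast
      have kN: "k \<ge> int N" using u(1) k(1) L(1) by simp
      have "approx_eigenvector (\<lambda>n. a (nat n)) (\<lambda>n. b (nat n)) z (3 * e) k (k + L - 1) v"
        using k(2) L(2) unfolding approx_eigenvector_def by auto
      from approx_eigenvector_translate[OF this, of k]
      have "approx_eigenvector (\<lambda>n. a (nat (n + int (nat k)))) (\<lambda>n. b (nat (n + int (nat k)))) z (3 * e) 0 (L - 1)
          (\<lambda>n. v (n + k))" using kN by simp
      then show ?thesis using kN by (intro exI[of _ "nat k"] conjI exI) auto
    qed
    then obtain ar br v where r: "(ar, br) \<in> right_limits a b" and v: "approx_eigenvector ar br z (3 * e) 0 (L - 1) v"
      using right_limit_of_localized_eigenvectors by blast
    interpret r: bounded_jacobi ar br K using right_limits_bounded[OF r bnd] .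
    obtain w where w: "w \<in> spectrum UNIV (jacobi_two_sided ar br)" "dist w z \<le> sqrt (3 * e)"
      using r.spectrum_near_approx_eigenvector[OF v im] by blast
    have "sqrt (3 * e) < d" using d by (intro real_less_lsqrt) (auto simp: e_def)
    then show "\<exists>y\<in>\<Union>(ar, br)\<in>right_limits a b. spectrum UNIV (jacobi_two_sided ar br). dist y z < d"
      using r w by (intro bexI[of _ w]) auto
  qed
qed

end

theorem theorem1p7:
  fixes a b :: "nat \<Rightarrow> real" and K :: real
  assumes "\<And>n. n \<ge> 1 \<Longrightarrow> a n > 0"
    and "K > 0"
    and "(SUP n\<in>{1..}. ereal \<bar>b n\<bar>) + (SUP n\<in>{1..}. ereal \<bar>a n\<bar>)
           + (SUP n\<in>{1..}. ereal (inverse \<bar>a n\<bar>)) \<le> ereal K"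
  shows "closure (\<Union>(ar, br)\<in>right_limits a b. spectrum UNIV (jacobi_two_sided ar br))
           = essential_spectrum {1..} (jacobi_one_sided a b)"
proof -
  let ?A = "SUP n\<in>{1..}. ereal \<bar>a n\<bar>" and ?B = "SUP n\<in>{1..}. ereal \<bar>b n\<bar>"
    and ?I = "SUP n\<in>{1..}. ereal (inverse \<bar>a n\<bar>)"
  have nonneg: "?A \<ge> 0" "?B \<ge> 0" "?I \<ge> 0"
    by (rule SUP_upper2[of 1]; simp)+
  have le: "\<bar>a n\<bar> \<le> K" "\<bar>b n\<bar> \<le> K" if n: "n \<ge> 1" for n
  proof -
    have "ereal \<bar>a n\<bar> \<le> ?A" "ereal \<bar>b n\<bar> \<le> ?B" using n by (auto intro: SUP_upper)
    moreover have "?A \<le> ?B + ?A + ?I" "?B \<le> ?B + ?A + ?I"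
      using nonneg by (simp_all add: add_increasing add_increasing2)
    ultimately have "ereal \<bar>a n\<bar> \<le> ereal K" "ereal \<bar>b n\<bar> \<le> ereal K" using assms(3) by (meson order_trans)+
    then show "\<bar>a n\<bar> \<le> K" "\<bar>b n\<bar> \<le> K" by simp_all
  qed
  \<comment> \<open>The two-sided extension repeats \<open>a 0\<close> and \<open>b 0\<close> at all
    nonpositive sites, so its uniform bound must cover these values too.\<close>
  define K' where "K' = max K (max \<bar>a 0\<bar> \<bar>b 0\<bar>)"
  interpret bounded_half_line_jacobi a b K'
  proof
    show "\<bar>a n\<bar> \<le> K'" "\<bar>b n\<bar> \<le> K'" for n
      using le[of n] by (cases "n = 0"; simp add: K'_def)+
  qed (fact assms(1))
  show ?thesis using closure_right_limit_spectra_subset essential_spectrum_subset by (rule antisym)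
qed

end
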